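(* Let $G$ be an $\mathcal{M}$-group with torsion-free nilpotent normal subgroup $K$ of finite Pr\"ufer rank such that $G/K$ is virtually abelian. If there exist constants $C_1,C_2>1$ and an integer $l>1$ such that $C_1^r\le|B_G(C_2r)\cap\gamma_l(K)|$ for all $r>0$ sufficiently large, then $r^{l+1}\preceq\mathrm{RF}_G$.
   Context: An $\mathcal{M}$-group is a finitely generated group $G$ that fits in a short exact sequence $1\to K\to G\to H\to 1$ with $K$ torsion-free nilpotent of finite Pr\"ufer rank and $H$ virtually abelian; such groups are residually finite. The Pr\"ufer rank of a group is the least value $\rho\in\mathbb{N}\cup\{\infty\}$ such that every finitely generated subgroup can be generated by at most $\rho$ elements. The lower central series is $\gamma_1(K)=K$, $\gamma_{i+1}(K)=[\gamma_i(K),K]$. For a group $G$ with finite generating set $S$, $B_G(r)=B_{G,S}(r)$ is the ball of radius $r$ around $e$ for the word norm of $S$ (a fixed finite generating set). If $G$ is residually finite, put $D_G(g)=\min\{[G:N] : N\lhd G,\ g\notin N\}$ for $e\neq g\in G$ and $\mathrm{RF}_{G,S}(r)=\max\{D_G(g) : e\neq g\in B_{G,S}(r)\}$ for $r\in\mathbb{R}_{\geq 1}$. For non-decreasing functions $f,g$ on $\mathbb{R}_{\ge1}$, $f\preceq g$ means that there is $C>0$ with $f(r)\le C g(Cr)$ for all $r\ge\max\{1,1/C\}$, and $f\approx g$ means $f\preceq g$ and $g\preceq f$. Up to $\approx$, $\mathrm{RF}_{G,S}$ does not depend on $S$ and is written $\mathrm{RF}_G$. Here $r^{a}$ denotes the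 function $r\mapsto r^a$. *)

theory Defs
  imports
    "HOL-Algebra.Algebra"
    "HOL-Library.Extended_Nonnegative_Real"
begin

text \<open>A subgroup \<open>K\<close> of \<open>G\<close> is regarded as a group in its own right via
  \<open>G\<lparr>carrier := K\<rparr>\<close>.\<close>

section \<open>Classes of groups\<close>

definition finite_generating_set :: "('a, 'b) monoid_scheme \<Rightarrow> 'a set \<Rightarrow> bool" where
  "finite_generating_set G S \<longleftrightarrow> finite S \<and> S \<subseteq> carrier G \<and> generate G S = carrier G"

definition finitely_generated :: "('a, 'b) monoid_scheme \<Rightarrow> bool" where
  "finitely_generated G \<longleftrightarrow> (\<exists>S. finite_generating_set G S)"

definition torsion_free :: "('a, 'b) monoid_scheme \<Rightarrow> bool" where
  "torsion_free G \<longleftrightarrow>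
     (\<forall>x \<in> carrier G. \<forall>n::nat. n > 0 \<longrightarrow> x [^]\<^bsub>G\<^esub> n = \<one>\<^bsub>G\<^esub> \<longrightarrow> x = \<one>\<^bsub>G\<^esub>)"

text \<open>The commutator convention is that of \<^const>\<open>derived\<close>; the generated subgroup
  does not depend on it.\<close>

definition commutator_subgroup :: "('a, 'b) monoid_scheme \<Rightarrow> 'a set \<Rightarrow> 'a set \<Rightarrow> 'a set" where
  "commutator_subgroup G A B =
     generate G (\<Union>a \<in> A. \<Union>b \<in> B. {a \<otimes>\<^bsub>G\<^esub> b \<otimes>\<^bsub>G\<^esub> inv\<^bsub>G\<^esub> a \<otimes>\<^bsub>G\<^esub> inv\<^bsub>G\<^esub> b})"

text \<open>Indexed from 1, so that the first term is the whole group; the value at 0 is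
  a dummy.\<close>

fun lower_central :: "('a, 'b) monoid_scheme \<Rightarrow> nat \<Rightarrow> 'a set" where
  "lower_central G 0 = carrier G"
| "lower_central G (Suc 0) = carrier G"
| "lower_central G (Suc (Suc i)) =
     commutator_subgroup G (lower_central G (Suc i)) (carrier G)"

definition nilpotent_group :: "('a, 'b) monoid_scheme \<Rightarrow> bool" where
  "nilpotent_group G \<longleftrightarrow> group G \<and> (\<exists>c. lower_central G (Suc c) = {\<one>\<^bsub>G\<^esub>})"

definition pruefer_rank :: "('a, 'b) monoid_scheme \<Rightarrow> enat" where
  "pruefer_rank G = (LEAST \<rho>. \<forall>H. subgroup H G \<and> finitely_generated (G\<lparr>carrier := H\<rparr>) \<longrightarrow>
     (\<exists>T. finite_generating_set (G\<lparr>carrier := H\<rparr>) T \<and> enat (card T) \<le> \<rho>))"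

definition virtually_abelian :: "('a, 'b) monoid_scheme \<Rightarrow> bool" where
  "virtually_abelian G \<longleftrightarrow> group G \<and>
     (\<exists>A. subgroup A G \<and> finite (rcosets\<^bsub>G\<^esub> A) \<and> comm_group (G\<lparr>carrier := A\<rparr>))"

definition M_group :: "('a, 'b) monoid_scheme \<Rightarrow> bool" where
  "M_group G \<longleftrightarrow> group G \<and> finitely_generated G \<and>
     (\<exists>K. K \<lhd> G \<and> torsion_free (G\<lparr>carrier := K\<rparr>) \<and> nilpotent_group (G\<lparr>carrier := K\<rparr>)
        \<and> pruefer_rank (G\<lparr>carrier := K\<rparr>) < \<infinity> \<and> virtually_abelian (G Mod K))"


section \<open>Word norm\<close>

definition is_word :: "('a, 'b) monoid_scheme \<Rightarrow> 'a set \<Rightarrow> 'a list \<Rightarrow> bool" where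
  "is_word G S ws \<longleftrightarrow> set ws \<subseteq> S \<union> set_inv\<^bsub>G\<^esub> S"

definition word_value :: "('a, 'b) monoid_scheme \<Rightarrow> 'a list \<Rightarrow> 'a" where
  "word_value G ws = foldr (\<otimes>\<^bsub>G\<^esub>) ws \<one>\<^bsub>G\<^esub>"

definition word_norm :: "('a, 'b) monoid_scheme \<Rightarrow> 'a set \<Rightarrow> 'a \<Rightarrow> nat" where
  "word_norm G S g = (LEAST n. \<exists>ws. is_word G S ws \<and> word_value G ws = g \<and> length ws = n)"

definition word_ball :: "('a, 'b) monoid_scheme \<Rightarrow> 'a set \<Rightarrow> real \<Rightarrow> 'a set" where
  "word_ball G S r = {g \<in> carrier G. real (word_norm G S g) \<le> r}"


section \<open>Residual finiteness growth\<close>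

definition residually_finite :: "('a, 'b) monoid_scheme \<Rightarrow> bool" where
  "residually_finite G \<longleftrightarrow>
     (\<forall>g \<in> carrier G. g \<noteq> \<one>\<^bsub>G\<^esub> \<longrightarrow> (\<exists>N. N \<lhd> G \<and> finite (rcosets\<^bsub>G\<^esub> N) \<and> g \<notin> N))"

definition subgroup_index :: "('a, 'b) monoid_scheme \<Rightarrow> 'a set \<Rightarrow> enat" where
  "subgroup_index G N = (if finite (rcosets\<^bsub>G\<^esub> N) then enat (card (rcosets\<^bsub>G\<^esub> N)) else \<infinity>)"

text \<open>Indices take values in \<open>\<nat> \<union> {\<infinity>}\<close>, so \<open>RF_depth\<close> and \<open>RF_growth\<close> are
  defined for every group. The lemmas below show that the infimum is a minimum, the supremum a
  maximum, and both are finite if \<open>G\<close> is residually finite.\<close>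

definition RF_depth :: "('a, 'b) monoid_scheme \<Rightarrow> 'a \<Rightarrow> enat" where
  "RF_depth G g = (INF N \<in> {N. N \<lhd> G \<and> g \<notin> N}. subgroup_index G N)"

definition RF_growth :: "('a, 'b) monoid_scheme \<Rightarrow> 'a set \<Rightarrow> real \<Rightarrow> enat" where
  "RF_growth G S r = (SUP g \<in> word_ball G S r - {\<one>\<^bsub>G\<^esub>}. RF_depth G g)"

text \<open>Only the values of the two functions on \<open>[1, \<infinity>)\<close> matter.\<close>

definition growth_le :: "(real \<Rightarrow> ennreal) \<Rightarrow> (real \<Rightarrow> ennreal) \<Rightarrow> bool" (infix \<open>\<preceq>\<close> 50) where
  "f \<preceq> g \<longleftrightarrow> (\<exists>C>0. \<forall>r. r \<ge> max 1 (1 / C) \<longrightarrow> f r \<le> ennreal C * g (C * r))"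


section \<open>Well-definedness\<close>

lemma pruefer_rank_le_iff:
  "pruefer_rank G \<le> \<rho> \<longleftrightarrow> (\<forall>H. subgroup H G \<and> finitely_generated (G\<lparr>carrier := H\<rparr>) \<longrightarrow>
     (\<exists>T. finite_generating_set (G\<lparr>carrier := H\<rparr>) T \<and> enat (card T) \<le> \<rho>))"
  (is "_ \<longleftrightarrow> ?P \<rho>")
proof -
  have "?P \<infinity>" by (auto simp: finitely_generated_def)
  then have "?P (pruefer_rank G)" unfolding pruefer_rank_def by (rule LeastI)
  then have "?P \<rho>" if "pruefer_rank G \<le> \<rho>" using that by (meson order_trans)
  moreover have "pruefer_rank G \<le> \<rho>" if "?P \<rho>"
    unfolding pruefer_rank_def using that by (rule Least_le)
  ultimately show ?thesis by blast
qed

lemma (in group) word_value_closed: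
  assumes "S \<subseteq> carrier G" "is_word G S ws"
  shows "word_value G ws \<in> carrier G"
  using assms(2)
proof (induction ws)
  case (Cons a ws)
  then have "a \<in> carrier G" using assms(1) by (auto simp: is_word_def SET_INV_def)
  with Cons show ?case by (auto simp: is_word_def word_value_def)
qed (simp add: word_value_def)

lemma (in group) word_value_append:
  assumes "S \<subseteq> carrier G" "is_word G S us" "is_word G S vs"
  shows "word_value G (us @ vs) = word_value G us \<otimes> word_value G vs"
  using assms(2)
proof (induction us)
  case Nil
  then show ?case using word_value_closed[OF assms(1,3)] by (simp add: word_value_def)
next
  case (Cons a us)
  then have "a \<in> carrier G" "is_word G S us"
    using assms(1) by (auto simp: is_word_def SET_INV_def)
  with Cons.IH word_value_closed[OF assms(1)] assms(3) show ?case
    by (simp add: word_value_def m_assoc)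
qed

lemma (in group) generate_imp_word:
  assumes "S \<subseteq> carrier G" "g \<in> generate G S"
  shows "\<exists>ws. is_word G S ws \<and> word_value G ws = g"
  using assms(2)
proof induction
  case one
  show ?case by (rule exI[of _ "[]"]) (simp add: is_word_def word_value_def)
next
  case (incl h)
  then show ?case using assms(1)
    by (intro exI[of _ "[h]"]) (auto simp: is_word_def word_value_def)
next
  case (inv h)
  then show ?case using assms(1)
    by (intro exI[of _ "[inv h]"]) (auto simp: is_word_def word_value_def SET_INV_def)
next
  case (eng g h)
  then obtain us vs where "is_word G S us" "word_value G us = g" "is_word G S vs" "word_value G vs = h"
    by blast
  then show ?case using word_value_append[OF assms(1)]
    by (intro exI[of _ "us @ vs"]) (auto simp: is_word_def)
qed

lemma (in group) word_ball_eq: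
  assumes "finite_generating_set G S"
  shows "word_ball G S r = {word_value G ws | ws. is_word G S ws \<and> real (length ws) \<le> r}"
proof (intro equalityI subsetI)
  fix g assume g: "g \<in> word_ball G S r"
  have "\<exists>n ws. is_word G S ws \<and> word_value G ws = g \<and> length ws = n"
    using generate_imp_word[of S g] g assms
    by (auto simp: word_ball_def finite_generating_set_def)
  then have "\<exists>ws. is_word G S ws \<and> word_value G ws = g \<and> length ws = word_norm G S g"
    unfolding word_norm_def by (rule LeastI_ex)
  then show "g \<in> {word_value G ws | ws. is_word G S ws \<and> real (length ws) \<le> r}"
    using g by (auto simp: word_ball_def)
next
  fix g assume "g \<in> {word_value G ws | ws. is_word G S ws \<and> real (length ws) \<le> r}"
  then obtain ws where ws: "is_word G S ws" "word_value G ws = g" "real (length ws) \<le> r" by blast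
  then have "word_norm G S g \<le> length ws" unfolding word_norm_def by (intro Least_le) auto
  then show "g \<in> word_ball G S r"
    using ws word_value_closed[of S ws] assms
    by (auto simp: word_ball_def finite_generating_set_def)
qed

lemma (in group) finite_word_ball:
  assumes "finite_generating_set G S"
  shows "finite (word_ball G S r)"
proof -
  have "finite (S \<union> set_inv S)"
    using assms by (auto simp: finite_generating_set_def SET_INV_def)
  then have "finite {ws. set ws \<subseteq> S \<union> set_inv S \<and> length ws \<le> nat \<lfloor>r\<rfloor>}"
    by (rule finite_lists_length_le)
  then have "finite (word_value G ` {ws. set ws \<subseteq> S \<union> set_inv S \<and> length ws \<le> nat \<lfloor>r\<rfloor>})"
    by (rule finite_imageI)
  then show ?thesis
    by (rule rev_finite_subset) (auto simp: word_ball_eq[OF assms] is_word_def le_nat_floor)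
qed

lemma (in group) RF_depth_attained:
  assumes "g \<noteq> \<one>"
  shows "\<exists>N. N \<lhd> G \<and> g \<notin> N \<and> RF_depth G g = subgroup_index G N"
proof -
  have "{\<one>} \<in> {N. N \<lhd> G \<and> g \<notin> N}" using assms by (simp add: one_is_normal)
  then have "subgroup_index G ` {N. N \<lhd> G \<and> g \<notin> N} \<noteq> {}" by blast
  then have "RF_depth G g \<in> subgroup_index G ` {N. N \<lhd> G \<and> g \<notin> N}"
    unfolding RF_depth_def Inf_enat_def by (metis (mono_tags, lifting) LeastI ex_in_conv)
  then show ?thesis by blast
qed

lemma RF_depth_finite:
  assumes "residually_finite G" "g \<in> carrier G" "g \<noteq> \<one>\<^bsub>G\<^esub>"
  shows "RF_depth G g < \<infinity>"
proof -
  obtain N where N: "N \<lhd> G" "finite (rcosets\<^bsub>G\<^esub> N)" "g \<notin> N"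
    using assms by (auto simp: residually_finite_def)
  then have "RF_depth G g \<le> subgroup_index G N"
    unfolding RF_depth_def by (intro INF_lower) auto
  also have "\<dots> < \<infinity>" using N by (simp add: subgroup_index_def)
  finally show ?thesis .
qed

lemma (in group) RF_growth_attained:
  assumes "finite_generating_set G S" "word_ball G S r - {\<one>} \<noteq> {}"
  shows "\<exists>g \<in> word_ball G S r - {\<one>}. RF_growth G S r = RF_depth G g"
proof -
  have "finite (RF_depth G ` (word_ball G S r - {\<one>}))"
    using finite_word_ball[OF assms(1)] by blast
  then have "RF_growth G S r \<in> RF_depth G ` (word_ball G S r - {\<one>})"
    unfolding RF_growth_def using assms(2) Max_in[of "RF_depth G ` (word_ball G S r - {\<one>})"]
    by (simp add: Max_Sup)
  then show ?thesis by blast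
qed

lemma RF_growth_mono: "r \<le> s \<Longrightarrow> RF_growth G S r \<le> RF_growth G S s"
  unfolding RF_growth_def by (rule SUP_subset_mono) (auto simp: word_ball_def)

end

theory Submission
  imports Defs
begin

text \<open>
  Let \<open>L\<close> be the \<open>l\<close>-th term of the lower central series of \<open>K\<close>, let \<open>c\<close> be the nilpotency class
  of \<open>K\<close> and \<open>\<rho>\<close> its rank. The proof finds, for every \<open>n\<close>, a nontrivial element of \<open>L\<close> of word
  length \<open>O(n)\<close> that lies in every normal subgroup of \<open>G\<close> of index less than \<open>(n + 1)^(l + 1)\<close>.

  Let \<open>N\<close> be such a normal subgroup and \<open>P\<close> the image of \<open>K\<close> in \<open>G Mod N\<close>, a finite nilpotent
  group. If a prime \<open>p\<close> divides the order of an element of the \<open>l\<close>-th term of the lower central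
  series of \<open>P\<close>, then \<open>p\<close> divides the orders of the first \<open>l\<close> factors of that series, because the
  commutator map transports exponents from each factor to the next. Moreover \<open>p^2\<close> divides the order
  of the abelianization: otherwise its \<open>p\<close>-part would be cyclic, and cyclic groups have no nontrivial
  commutators. So \<open>p^(l + 1)\<close> divides the order of \<open>P\<close> (lemma \<open>prime_power_dvd_order\<close>), and
  \<open>p \<le> n\<close>. The second factor \<open>p\<close> at the bottom is where \<open>l > 1\<close> enters.

  Hence the image of \<open>L\<close> has exponent dividing \<open>E = Lcm {1..n} ^ (2 * l + 1)\<close>, which does not depend
  on \<open>N\<close> (lemma \<open>lower_central_exponent\<close>), and the intersection \<open>J\<close> of all these \<open>N\<close> contains all
  \<open>E\<close>-th powers of elements of \<open>L\<close>. The image of \<open>L\<close> modulo \<open>J\<close> is solvable of derived length at most \<open>c\<close>, rank at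
  most \<open>\<rho>\<close> and exponent dividing \<open>E\<close>, so it has at most \<open>E ^ (\<rho> * c)\<close> elements (lemma
  \<open>card_solvable_bounded_exponent\<close>). As \<open>Lcm {1..n} \<le> 4 ^ n\<close> when \<open>n\<close> is a power of two (lemma
  \<open>Lcm_upto_power2_le\<close>), this number grows at most exponentially in \<open>n\<close>. By hypothesis a ball of
  radius \<open>O(n)\<close> contains more elements of \<open>L\<close> than that, so two of them agree modulo \<open>J\<close>, and their
  quotient is the required element.
\<close>

section \<open>An exponential bound for least common multiples\<close>

text \<open>The identity \<open>i * (p^a choose i) = p^a * ((p^a - 1) choose (i - 1))\<close> puts the whole power \<open>p^a\<close> on the right-hand side,
  while \<open>i\<close> is too small to absorb it.\<close>

lemma prime_dvd_prime_power_choose: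
  fixes p :: nat
  assumes "Factorial_Ring.prime p" "0 < i" "i < p ^ a"
  shows "p dvd (p ^ a choose i)"
proof (rule ccontr)
  assume "\<not> p dvd (p ^ a choose i)"
  then have "coprime (p ^ a) (p ^ a choose i)"
    using assms(1) by (simp add: prime_imp_coprime)
  moreover have "i * (p ^ a choose i) = p ^ a * ((p ^ a - 1) choose (i - 1))"
    using assms by (simp add: times_binomial_minus1_eq)
  ultimately have "p ^ a dvd i"
    by (metis coprime_dvd_mult_left_iff dvd_triv_left)
  with assms show False by (auto dest: dvd_imp_le)
qed

text \<open>Modulo \<open>p\<close>, raising to the power \<open>p^a\<close> is additive, so \<open>(1 + x)^(2 * m)\<close> is congruent to
  \<open>(1 + x^(p^a)) * (1 + x)^(2 * m - p^a)\<close>, and the coefficient of \<open>x^m\<close> on the right vanishes because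
  \<open>2 * m - p^a < m < p^a\<close>. Vandermonde's identity expresses this without polynomials.\<close>

lemma prime_dvd_central_binomial:
  fixes p :: nat
  assumes p: "Factorial_Ring.prime p" and a: "m < p ^ a" "p ^ a \<le> 2 * m"
  shows "p dvd (2 * m choose m)"
proof -
  have "(2 * m choose m) = (\<Sum>k\<le>m. (p ^ a choose k) * ((2 * m - p ^ a) choose (m - k)))"
    using vandermonde[of "p ^ a" "2 * m - p ^ a" m] a by simp
  moreover have "p dvd (p ^ a choose k) * ((2 * m - p ^ a) choose (m - k))" if "k \<le> m" for k
  proof (cases "k = 0")
    case True
    then show ?thesis using a by (simp add: binomial_eq_0)
  next
    case False
    then show ?thesis using prime_dvd_prime_power_choose[OF p, of k a] that a by simp
  qed
  ultimately show ?thesis by (metis (no_types, lifting) atMost_iff dvd_sum)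
qed

lemma dvd_if_prime_powers_dvd:
  fixes x y :: nat
  assumes "x \<noteq> 0" "y \<noteq> 0" "\<And>p k. Factorial_Ring.prime p \<Longrightarrow> p ^ k dvd x \<Longrightarrow> p ^ k dvd y"
  shows "x dvd y"
proof (rule multiplicity_le_imp_dvd[OF assms(1)])
  fix p :: nat assume p: "Factorial_Ring.prime p"
  show "multiplicity p x \<le> multiplicity p y"
    using assms(2) p not_prime_unit by (intro multiplicity_geI assms(3) multiplicity_dvd) auto
qed

text \<open>If a prime power \<open>p^k \<le> 2 * m\<close> does not already divide the least common multiple of the
  numbers up to \<open>m\<close>, then \<open>m < p^k\<close>, while \<open>p^(k-1)\<close> does divide it; the missing
  factor \<open>p\<close> is supplied by the central binomial coefficient.\<close>

lemma Lcm_upto_double_dvd: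
  "Lcm {1..2 * m} dvd Lcm {1..m} * (2 * m choose m :: nat)"
proof (rule Lcm_least)
  fix j assume j: "j \<in> {1..2 * m}"
  have "Lcm {1..m} \<noteq> (0::nat)" by (simp add: Lcm_0_iff)
  then have nz: "Lcm {1..m} * (2 * m choose m) \<noteq> 0" by simp
  show "j dvd Lcm {1..m} * (2 * m choose m)"
  proof (rule dvd_if_prime_powers_dvd)
    fix p k :: nat assume p: "Factorial_Ring.prime p" and k: "p ^ k dvd j"
    have le: "p ^ k \<le> 2 * m" using dvd_imp_le[OF k] j by auto
    have pos: "p ^ i \<ge> 1" for i using prime_gt_0_nat[OF p] by (simp add: Suc_leI)
    show "p ^ k dvd Lcm {1..m} * (2 * m choose m)"
    proof (cases "p ^ k \<le> m")
      case True
      then show ?thesis using pos by (intro dvd_mult2 dvd_Lcm) auto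
    next
      case False
      then obtain i where i: "k = Suc i" using j by (cases k) auto
      have "2 * p ^ i \<le> p ^ k" using i prime_ge_2_nat[OF p] by simp
      then have "p ^ i dvd Lcm {1..m}" using le pos by (intro dvd_Lcm) auto
      moreover have "p dvd (2 * m choose m)"
        using prime_dvd_central_binomial[OF p, of m k] False le by simp
      ultimately have "p ^ i * p dvd Lcm {1..m} * (2 * m choose m)" by (rule mult_dvd_mono)
      then show ?thesis using i by (simp add: mult.commute)
    qed
  qed (use j nz in auto)
qed

text \<open>A Chebyshev bound by repeated doubling: each doubling of the range costs a central binomial
  coefficient. Powers of two are enough below, since a growth rate only sees its argument up to a
  constant factor.\<close>

lemma Lcm_upto_power2_le: "Lcm {1..2 ^ k} \<le> (4::nat) ^ (2 ^ k)"
proof (induction k)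
  case (Suc k)
  let ?m = "2 ^ k :: nat"
  have "Lcm {1..?m} \<noteq> (0::nat)" by (simp add: Lcm_0_iff)
  then have "Lcm {1..?m} * (2 * ?m choose ?m) \<noteq> 0" by simp
  then have "Lcm {1..2 * ?m} \<le> Lcm {1..?m} * (2 * ?m choose ?m)"
    by (intro dvd_imp_le Lcm_upto_double_dvd) blast
  also have "\<dots> \<le> 4 ^ ?m * 2 ^ (2 * ?m)"
    by (intro mult_mono Suc.IH binomial_le_pow2) auto
  also have "\<dots> = 4 ^ (2 ^ Suc k)" by (simp add: power_mult flip: power_add mult_2)
  finally show ?case by simp
qed simp

text \<open>The exponent \<open>2 * l + 1\<close>: if \<open>a\<close> is the largest exponent with \<open>p^a \<le> n\<close>, then
  \<open>p^k < (n + 1)^(l + 1) \<le> p^((a + 1) * (l + 1))\<close> forces \<open>k \<le> a * l + a + l\<close>, and this is at most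
  \<open>a * (2 * l + 1)\<close> because \<open>a \<ge> 1\<close>.\<close>

lemma prime_power_dvd_Lcm_power:
  fixes p :: nat
  assumes p: "Factorial_Ring.prime p" "p \<le> n" and k: "p ^ k < (n + 1) ^ (l + 1)"
  shows "p ^ k dvd Lcm {1..n} ^ (2 * l + 1)"
proof -
  obtain a where a: "p ^ a \<le> n" "n < p ^ (a + 1)"
    using ex_power_ivl1[of p n] p prime_ge_2_nat[of p] by auto
  have "a \<ge> 1" using a p by (cases a) auto
  have "p ^ k < (p ^ (a + 1)) ^ (l + 1)"
    using a by (intro less_le_trans[OF k] power_mono) auto
  then have "p ^ k < p ^ ((a + 1) * (l + 1))" by (simp only: power_mult)
  then have "k < (a + 1) * (l + 1)" using p(1) power_less_imp_less_exp prime_gt_1_nat by blast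
  also have "\<dots> = a * l + a + l + 1" by (simp add: algebra_simps)
  finally have "k \<le> a * l + a + l" by simp
  also have "\<dots> \<le> a * (2 * l + 1)" using \<open>a \<ge> 1\<close> by (simp add: algebra_simps)
  finally have "p ^ k dvd (p ^ a) ^ (2 * l + 1)" by (metis le_imp_power_dvd power_mult)
  also have "p ^ a dvd Lcm {1..n}"
    using a(1) prime_gt_0_nat[OF p(1)] by (intro dvd_Lcm) (simp add: Suc_leI)
  then have "(p ^ a) ^ (2 * l + 1) dvd Lcm {1..n} ^ (2 * l + 1)" by (rule dvd_power_same)
  finally show ?thesis .
qed

section \<open>Commutators and the lower central series\<close>

context group
begin

abbreviation (input) commutator :: "'a \<Rightarrow> 'a \<Rightarrow> 'a" where
  "commutator a b \<equiv> a \<otimes> b \<otimes> inv a \<otimes> inv b"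

lemma inv_mult_cancel:
  assumes "g \<in> carrier G" "x \<in> carrier G"
  shows "inv g \<otimes> (g \<otimes> x) = x" "g \<otimes> (inv g \<otimes> x) = x"
  using assms by (metis inv_closed l_inv l_one m_assoc, metis inv_closed r_inv l_one m_assoc)

lemma commutator_mult_swap:
  assumes "a \<in> carrier G" "b \<in> carrier G"
  shows "commutator a b \<otimes> (b \<otimes> a) = a \<otimes> b"
  using assms by (simp add: m_assoc inv_mult_cancel)

lemma commutator_eqI:
  assumes "a \<in> carrier G" "b \<in> carrier G" "z \<in> carrier G" "a \<otimes> b = z \<otimes> (b \<otimes> a)"
  shows "commutator a b = z"
  using assms(1-3) by (simp add: assms(4) m_assoc)

text \<open>Commutators are multiplicative in an argument with which they commute; this is the bilinearity
  of the commutator map between consecutive factors of a central series.\<close>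

lemma commutator_pow_left:
  assumes "a \<in> carrier G" "b \<in> carrier G"
    and comm: "commutator a b \<otimes> a = a \<otimes> commutator a b"
  shows "commutator (a [^] (k::nat)) b = commutator a b [^] k"
proof -
  define z where "z = commutator a b"
  have z: "z \<in> carrier G" "z \<otimes> a = a \<otimes> z" "a \<otimes> b = z \<otimes> (b \<otimes> a)"
    using assms commutator_mult_swap[of a b] by (auto simp: z_def)
  have "a [^] k \<otimes> b = z [^] k \<otimes> (b \<otimes> a [^] k)"
  proof (induction k)
    case (Suc k)
    have "a [^] Suc k \<otimes> b = (a [^] k \<otimes> z) \<otimes> (b \<otimes> a)"
      using assms z by (simp add: m_assoc)
    also have "a [^] k \<otimes> z = z \<otimes> a [^] k"
      using z assms by (intro group_commutes_pow) auto
    also have "z \<otimes> a [^] k \<otimes> (b \<otimes> a) = z \<otimes> (a [^] k \<otimes> b) \<otimes> a"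
      using assms z(1) by (simp add: m_assoc)
    also have "\<dots> = z [^] Suc k \<otimes> (b \<otimes> a [^] Suc k)"
      unfolding Suc.IH nat_pow_Suc2[OF z(1)] using assms z(1) by (simp add: m_assoc)
    finally show ?case .
  qed (use assms in simp)
  then show ?thesis unfolding z_def[symmetric] using assms z(1) by (intro commutator_eqI) auto
qed

lemma commutator_pow_right:
  assumes "a \<in> carrier G" "b \<in> carrier G"
    and comm: "commutator a b \<otimes> b = b \<otimes> commutator a b"
  shows "commutator a (b [^] (k::nat)) = commutator a b [^] k"
proof -
  define z where "z = commutator a b"
  have z: "z \<in> carrier G" "z \<otimes> b = b \<otimes> z" "a \<otimes> b = z \<otimes> (b \<otimes> a)"
    using assms commutator_mult_swap[of a b] by (auto simp: z_def)
  have "a \<otimes> b [^] k = z [^] k \<otimes> (b [^] k \<otimes> a)"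
  proof (induction k)
    case (Suc k)
    have "a \<otimes> b [^] Suc k = (a \<otimes> b [^] k) \<otimes> b"
      using assms z(1) by (simp add: m_assoc)
    also have "\<dots> = z [^] k \<otimes> b [^] k \<otimes> (a \<otimes> b)"
      unfolding Suc.IH using assms z(1) by (simp add: m_assoc)
    also have "\<dots> = z [^] k \<otimes> (b [^] k \<otimes> z) \<otimes> (b \<otimes> a)"
      unfolding z(3) using assms z(1) by (simp add: m_assoc)
    also have "b [^] k \<otimes> z = z \<otimes> b [^] k"
      using z assms by (intro group_commutes_pow) auto
    also have "z [^] k \<otimes> (z \<otimes> b [^] k) \<otimes> (b \<otimes> a) = z [^] Suc k \<otimes> (b [^] Suc k \<otimes> a)"
      using assms z(1) by (simp add: m_assoc)
    finally show ?case .
  qed (use assms in simp)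
  then show ?thesis unfolding z_def[symmetric] using assms z(1) by (intro commutator_eqI) auto
qed

lemma conj_commutator:
  assumes "a \<in> carrier G" "b \<in> carrier G" "g \<in> carrier G"
  shows "g \<otimes> commutator a b \<otimes> inv g
    = commutator (g \<otimes> a \<otimes> inv g) (g \<otimes> b \<otimes> inv g)"
  using assms by (simp add: m_assoc inv_mult_group inv_mult_cancel)

lemma lower_central_normal: "lower_central G (Suc i) \<lhd> G"
proof (induction i)
  case 0
  show ?case by (simp add: normal_self)
next
  case (Suc i)
  have sub: "lower_central G (Suc i) \<subseteq> carrier G"
    using Suc.IH normal_imp_subgroup subgroup.subset by blast
  show ?case unfolding lower_central.simps commutator_subgroup_def
  proof (rule normal_generateI)
    fix h g assume h: "h \<in> (\<Union>a\<in>lower_central G (Suc i). \<Union>b\<in>carrier G. {commutator a b})"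
      and g: "g \<in> carrier G"
    then obtain a b where ab: "a \<in> lower_central G (Suc i)" "b \<in> carrier G" "h = commutator a b"
      by auto
    have "g \<otimes> h \<otimes> inv g = commutator (g \<otimes> a \<otimes> inv g) (g \<otimes> b \<otimes> inv g)"
      unfolding ab(3) using ab sub g by (intro conj_commutator) auto
    moreover have "g \<otimes> a \<otimes> inv g \<in> lower_central G (Suc i)"
      using Suc.IH g ab by (intro normal_invE(2))
    ultimately show "g \<otimes> h \<otimes> inv g \<in> (\<Union>a\<in>lower_central G (Suc i). \<Union>b\<in>carrier G. {commutator a b})"
      using g ab by auto
  qed (use sub in auto)
qed

lemma lower_central_subgroup: "subgroup (lower_central G (Suc i)) G"
  by (rule normal_imp_subgroup[OF lower_central_normal])

lemma lower_central_subset: "lower_central G (Suc i) \<subseteq> carrier G"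
  by (rule subgroup.subset[OF lower_central_subgroup])

lemma commutator_in_lower_central:
  assumes "a \<in> lower_central G (Suc i)" "b \<in> carrier G"
  shows "commutator a b \<in> lower_central G (Suc (Suc i))"
  using assms by (auto simp: commutator_subgroup_def intro!: generate.incl)

lemma lower_central_Suc_le: "lower_central G (Suc (Suc i)) \<subseteq> lower_central G (Suc i)"
  unfolding lower_central.simps commutator_subgroup_def
proof (rule generate_subgroup_incl[OF _ lower_central_subgroup], clarify)
  fix a b assume a: "a \<in> lower_central G (Suc i)" and b: "b \<in> carrier G"
  have aG: "a \<in> carrier G" using a lower_central_subset by blast
  have "b \<otimes> inv a \<otimes> inv b \<in> lower_central G (Suc i)"
    using normal_invE(2)[OF lower_central_normal b subgroup.m_inv_closed[OF lower_central_subgroup a]] .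
  then have "a \<otimes> (b \<otimes> inv a \<otimes> inv b) \<in> lower_central G (Suc i)"
    by (rule subgroup.m_closed[OF lower_central_subgroup a])
  then show "commutator a b \<in> lower_central G (Suc i)"
    using aG b by (simp add: m_assoc)
qed

lemma lower_central_antimono:
  "i \<le> j \<Longrightarrow> lower_central G (Suc j) \<subseteq> lower_central G (Suc i)"
  by (induction rule: dec_induct) (use lower_central_Suc_le in blast)+

lemma quotient_map_hom: "N \<lhd> G \<Longrightarrow> group_hom G (G Mod N) (\<lambda>x. N #> x)"
  by (simp add: group_hom_def group_hom_axioms_def normal.factorgroup_is_group normal.r_coset_hom_Mod)

lemma quotient_map_eq_one_iff:
  assumes "N \<lhd> G" "x \<in> carrier G"
  shows "N #> x = \<one>\<^bsub>G Mod N\<^esub> \<longleftrightarrow> x \<in> N"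
  unfolding FactGroup_def using assms
  by (metis coset_join1 coset_join2 monoid.select_convs(2) normal_imp_subgroup)

text \<open>Computations modulo \<open>N\<close> take place in an opaque group \<open>Q\<close>, so that the
  simplifier does not rewrite them into products of cosets.\<close>

lemma normal_eq_kernel:
  assumes N: "N \<lhd> G"
  obtains Q :: "'a set monoid" and q
  where "group_hom G Q q" "\<And>x. x \<in> carrier G \<Longrightarrow> q x = \<one>\<^bsub>Q\<^esub> \<longleftrightarrow> x \<in> N"
  using quotient_map_hom[OF N] quotient_map_eq_one_iff[OF N] by blast

end

context group_hom
begin

lemma hom_commutator:
  assumes "x \<in> carrier G" "y \<in> carrier G"
  shows "h (G.commutator x y) = H.commutator (h x) (h y)"
  using assms by simp

lemma images_commute:
  assumes "x \<in> carrier G" "y \<in> carrier G" "h (G.commutator x y) = \<one>\<^bsub>H\<^esub>"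
  shows "h x \<otimes>\<^bsub>H\<^esub> h y = h y \<otimes>\<^bsub>H\<^esub> h x"
  using assms H.commutator_mult_swap[of "h x" "h y"] by simp

end

context group
begin

lemma commutator_pow_mem_left:
  assumes N: "N \<lhd> G" and ab: "a \<in> carrier G" "b \<in> carrier G"
    and c: "commutator (commutator a b) a \<in> N" and k: "commutator (a [^] (k::nat)) b \<in> N"
  shows "commutator a b [^] k \<in> N"
proof -
  obtain Q :: "'a set monoid" and q where q: "group_hom G Q q"
    and ker: "\<And>x. x \<in> carrier G \<Longrightarrow> q x = \<one>\<^bsub>Q\<^esub> \<longleftrightarrow> x \<in> N"
    using normal_eq_kernel[OF N] by metis
  interpret q: group_hom G Q q by (rule q)
  have "q (commutator a b) \<otimes>\<^bsub>Q\<^esub> q a = q a \<otimes>\<^bsub>Q\<^esub> q (commutator a b)"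
    using ab c by (intro q.images_commute iffD2[OF ker]) simp_all
  then have "q (commutator a b [^] k) = q (commutator (a [^] k) b)"
    using q.H.commutator_pow_left[of "q a" "q b" k] ab by (simp add: q.hom_nat_pow)
  then show ?thesis
    using k ab ker[of "commutator a b [^] k"] ker[of "commutator (a [^] k) b"] by simp
qed

lemma commutator_pow_mem_right:
  assumes N: "N \<lhd> G" and ab: "a \<in> carrier G" "b \<in> carrier G"
    and c: "commutator (commutator a b) b \<in> N" and k: "commutator a (b [^] (k::nat)) \<in> N"
  shows "commutator a b [^] k \<in> N"
proof -
  obtain Q :: "'a set monoid" and q where q: "group_hom G Q q"
    and ker: "\<And>x. x \<in> carrier G \<Longrightarrow> q x = \<one>\<^bsub>Q\<^esub> \<longleftrightarrow> x \<in> N"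
    using normal_eq_kernel[OF N] by metis
  interpret q: group_hom G Q q by (rule q)
  have "q (commutator a b) \<otimes>\<^bsub>Q\<^esub> q b = q b \<otimes>\<^bsub>Q\<^esub> q (commutator a b)"
    using ab c by (intro q.images_commute iffD2[OF ker]) simp_all
  then have "q (commutator a b [^] k) = q (commutator a (b [^] k))"
    using q.H.commutator_pow_right[of "q a" "q b" k] ab by (simp add: q.hom_nat_pow)
  then show ?thesis
    using k ab ker[of "commutator a b [^] k"] ker[of "commutator a (b [^] k)"] by simp
qed

text \<open>The factor in question is abelian, so an exponent only has to be checked on the commutators that
  generate it.\<close>

lemma lower_central_pow_mem:
  assumes gens: "\<And>a b. a \<in> lower_central G (Suc i) \<Longrightarrow> b \<in> carrier G \<Longrightarrow>
      commutator a b [^] (m::nat) \<in> lower_central G (Suc (Suc (Suc i)))"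
    and x: "x \<in> lower_central G (Suc (Suc i))"
  shows "x [^] m \<in> lower_central G (Suc (Suc (Suc i)))"
proof -
  define N where "N = lower_central G (Suc (Suc (Suc i)))"
  have N: "N \<lhd> G" unfolding N_def by (rule lower_central_normal)
  obtain Q :: "'a set monoid" and q where q: "group_hom G Q q"
    and ker: "\<And>x. x \<in> carrier G \<Longrightarrow> q x = \<one>\<^bsub>Q\<^esub> \<longleftrightarrow> x \<in> N"
    using normal_eq_kernel[OF N] by metis
  interpret q: group_hom G Q q by (rule q)
  define C where "C = (\<Union>a\<in>lower_central G (Suc i). \<Union>b\<in>carrier G. {commutator a b})"
  have gen: "lower_central G (Suc (Suc i)) = generate G C"
    unfolding C_def lower_central.simps commutator_subgroup_def ..
  have sub: "generate G C \<subseteq> carrier G" using gen lower_central_subset by blast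
  have C: "c \<in> carrier G" "q c [^]\<^bsub>Q\<^esub> m = \<one>\<^bsub>Q\<^esub>" if cC: "c \<in> C" for c
  proof -
    show c: "c \<in> carrier G" by (rule subsetD[OF sub generate.incl[OF cC]])
    obtain a b where "a \<in> lower_central G (Suc i)" "b \<in> carrier G" "c = commutator a b"
      using cC unfolding C_def by blast
    then have "c [^] m \<in> N" using gens[of a b] unfolding N_def by metis
    then show "q c [^]\<^bsub>Q\<^esub> m = \<one>\<^bsub>Q\<^esub>"
      using c ker[of "c [^] m"] by (simp add: q.hom_nat_pow)
  qed
  from x have "x \<in> generate G C" unfolding gen .
  then have "q x [^]\<^bsub>Q\<^esub> m = \<one>\<^bsub>Q\<^esub>"
  proof induction
    case (inv c)
    then show ?case using C by (simp add: q.H.nat_pow_inv)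
  next
    case (eng x y)
    then have xy: "x \<in> carrier G" "y \<in> carrier G" using sub by auto
    have "commutator x y \<in> N"
      unfolding N_def using eng.hyps(1) xy(2) unfolding gen[symmetric]
      by (rule commutator_in_lower_central)
    then have "q x \<otimes>\<^bsub>Q\<^esub> q y = q y \<otimes>\<^bsub>Q\<^esub> q x"
      using xy by (intro q.images_commute iffD2[OF ker]) simp_all
    then have "q (x \<otimes> y) [^]\<^bsub>Q\<^esub> m = q x [^]\<^bsub>Q\<^esub> m \<otimes>\<^bsub>Q\<^esub> q y [^]\<^bsub>Q\<^esub> m"
      using xy q.H.pow_mult_distrib by simp
    then show ?case using eng by simp
  qed (use C in auto)
  moreover have "x \<in> carrier G" using x lower_central_subset by blast
  ultimately show ?thesis
    using ker[of "x [^] m"] by (simp add: q.hom_nat_pow N_def)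
qed

section \<open>Prime divisors of a finite nilpotent group\<close>

lemma pow_card_rcosets_mem:
  assumes N: "N \<lhd> G" and x: "x \<in> carrier G"
  shows "x [^] card (rcosets N) \<in> N"
proof -
  interpret q: group_hom G "G Mod N" "\<lambda>x. N #> x" by (rule quotient_map_hom[OF N])
  have "(N #> x) [^]\<^bsub>G Mod N\<^esub> order (G Mod N) = \<one>\<^bsub>G Mod N\<^esub>"
    using x by (intro q.H.pow_order_eq_1 q.hom_closed)
  moreover have "order (G Mod N) = card (rcosets N)"
    by (simp add: order_def FactGroup_def)
  ultimately have "N #> (x [^] card (rcosets N)) = \<one>\<^bsub>G Mod N\<^esub>"
    using q.hom_nat_pow[OF x] by metis
  then show ?thesis using quotient_map_eq_one_iff[OF N] x nat_pow_closed by blast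
qed

text \<open>For a finite group and a prime \<open>p\<close>, this says that \<open>p\<close> does not divide the index of two consecutive terms of
  the lower central series. The formulation by exponents is the one that commutators pass on from
  one factor to the next.\<close>

definition coprime_lower_central_factor :: "nat \<Rightarrow> nat \<Rightarrow> bool" where
  "coprime_lower_central_factor p i \<longleftrightarrow>
    (\<exists>m::nat. \<not> p dvd m \<and> (\<forall>x \<in> lower_central G i. x [^] m \<in> lower_central G (Suc i)))"

text \<open>Modulo the next term, \<open>[a, b]^m = [a^m, b]\<close>; so an exponent of one factor is also an
  exponent of the following one.\<close>

lemma coprime_lower_central_factor_step:
  assumes "coprime_lower_central_factor p (Suc i)"
  shows "coprime_lower_central_factor p (Suc (Suc i))"
proof -
  obtain m :: nat where m: "\<not> p dvd m"
    "\<And>x. x \<in> lower_central G (Suc i) \<Longrightarrow> x [^] m \<in> lower_central G (Suc (Suc i))"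
    using assms unfolding coprime_lower_central_factor_def by blast
  have "commutator a b [^] m \<in> lower_central G (Suc (Suc (Suc i)))"
    if a: "a \<in> lower_central G (Suc i)" and b: "b \<in> carrier G" for a b
  proof -
    have aG: "a \<in> carrier G" using a lower_central_subset by blast
    show ?thesis
      by (rule commutator_pow_mem_left[OF lower_central_normal aG b
            commutator_in_lower_central[OF commutator_in_lower_central[OF a b] aG]
            commutator_in_lower_central[OF m(2)[OF a] b]])
  qed
  then have "\<forall>x \<in> lower_central G (Suc (Suc i)). x [^] m \<in> lower_central G (Suc (Suc (Suc i)))"
    using lower_central_pow_mem by blast
  with m(1) show ?thesis unfolding coprime_lower_central_factor_def by blast
qed

lemma coprime_lower_central_factor_mono:
  assumes "coprime_lower_central_factor p (Suc i)" "i \<le> j"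
  shows "coprime_lower_central_factor p (Suc j)"
  using assms(2,1) by (induction rule: dec_induct) (simp_all add: coprime_lower_central_factor_step)

lemma derived_carrier_eq: "derived G (carrier G) = lower_central G (Suc (Suc 0))"
  by (simp add: derived_def commutator_subgroup_def)

text \<open>The abelianization is the direct product of a cyclic group of order \<open>p\<close> and a group whose
  order \<open>m\<close> is prime to \<open>p\<close>, so its \<open>m\<close>-th powers form a cyclic group.
  Instead of decomposing it, take any nontrivial \<open>m\<close>-th power: it generates a subgroup of
  order \<open>p\<close>, hence of index \<open>m\<close>.\<close>

lemma powers_in_cyclic_mod_derived:
  fixes p m :: nat
  assumes p: "Factorial_Ring.prime p" "\<not> p dvd m"
    and fin: "finite (carrier G)"
    and card: "card (rcosets (derived G (carrier G))) = p * m"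
  obtains t where "t \<in> carrier G"
    "\<And>x. x \<in> carrier G \<Longrightarrow> \<exists>k::nat. \<exists>g \<in> derived G (carrier G). x [^] m = g \<otimes> t [^] k"
proof (cases "\<forall>x \<in> carrier G. x [^] m \<in> derived G (carrier G)")
  case True
  have "\<exists>k::nat. \<exists>g \<in> derived G (carrier G). x [^] m = g \<otimes> \<one> [^] k" if x: "x \<in> carrier G" for x
    by (rule exI[of _ 0], rule bexI[of _ "x [^] m"]) (use x True in auto)
  then show ?thesis by (rule that[OF one_closed])
next
  case False
  define D where "D = derived G (carrier G)"
  have D: "D \<lhd> G" unfolding D_def by (rule derived_self_is_normal)
  obtain s where s: "s \<in> carrier G" "s [^] m \<notin> D" using False unfolding D_def by blast
  interpret q: group_hom G "G Mod D" "\<lambda>x. D #> x" by (rule quotient_map_hom[OF D])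
  interpret A: comm_group "G Mod D" unfolding D_def by (rule derived_quot_is_comm_group)
  have ordA: "order (G Mod D) = p * m"
    using card by (simp add: order_def FactGroup_def D_def)
  have finA: "finite (carrier (G Mod D))"
    using fin by (simp add: FactGroup_def RCOSETS_def)
  define t where "t = s [^] m"
  have t: "t \<in> carrier G" "t \<notin> D" using s by (auto simp: t_def)
  define u where "u = D #> t"
  have u: "u \<in> carrier (G Mod D)" "u \<noteq> \<one>\<^bsub>G Mod D\<^esub>"
    using t quotient_map_eq_one_iff[OF D t(1)] q.hom_closed unfolding u_def by auto
  have "u [^]\<^bsub>G Mod D\<^esub> p = \<one>\<^bsub>G Mod D\<^esub>"
  proof -
    have "t [^] p \<in> D"
      using pow_card_rcosets_mem[OF D s(1)] card s(1)
      by (simp add: t_def nat_pow_pow D_def mult.commute)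
    then show ?thesis
      using quotient_map_eq_one_iff[OF D, of "t [^] p"] t q.hom_nat_pow[of t p]
      unfolding u_def by (metis nat_pow_closed)
  qed
  then have "q.H.ord u dvd p" using q.H.pow_eq_id[OF u(1)] by blast
  moreover have "q.H.ord u \<noteq> 1" using q.H.ord_eq_1[OF u(1)] u(2) by blast
  ultimately have ordu: "q.H.ord u = p" using p(1) by (metis prime_nat_iff)
  define U where "U = generate (G Mod D) {u}"
  have subU: "subgroup U (G Mod D)" unfolding U_def by (rule q.H.generate_is_subgroup) (use u in auto)
  have "card (rcosets\<^bsub>G Mod D\<^esub> U) * p = p * m"
    using q.H.lagrange[OF subU] ordA q.H.generate_pow_card[OF u(1)] ordu by (simp add: U_def)
  then have idx: "card (rcosets\<^bsub>G Mod D\<^esub> U) = m" using p(1) by auto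
  have "\<exists>k::nat. \<exists>g \<in> D. x [^] m = g \<otimes> t [^] k" if x: "x \<in> carrier G" for x
  proof -
    have "(D #> x) [^]\<^bsub>G Mod D\<^esub> m \<in> U"
      using q.H.pow_card_rcosets_mem[OF A.subgroup_imp_normal[OF subU] q.hom_closed[OF x]] idx by simp
    then obtain k :: nat where "(D #> x) [^]\<^bsub>G Mod D\<^esub> m = u [^]\<^bsub>G Mod D\<^esub> k"
      unfolding U_def q.H.generate_pow_on_finite_carrier[OF finA u(1)] by blast
    then have "D #> (x [^] m) = D #> (t [^] k)"
      using q.hom_nat_pow[OF x] q.hom_nat_pow[OF t(1)] unfolding u_def by metis
    then have "x [^] m \<in> D #> (t [^] k)"
      using rcos_self[OF nat_pow_closed[OF x] normal_imp_subgroup[OF D], of m] by simp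
    then show ?thesis unfolding r_coset_def by blast
  qed
  with t(1) show ?thesis unfolding D_def by (rule that)
qed

text \<open>A group that is cyclic modulo its centre is abelian. Here the \<open>m\<close>-th powers are cyclic modulo
  the derived subgroup, which is central modulo the third term; hence they commute there, and
  \<open>[x, y]^(m * m) = [x^m, y^m]\<close> is trivial. This is the source of the second factor \<open>p\<close> at the
  bottom of the lower central series.\<close>

lemma coprime_second_lower_central_factor:
  assumes p: "Factorial_Ring.prime p" and fin: "finite (carrier G)"
    and card: "\<not> p\<^sup>2 dvd card (rcosets (lower_central G (Suc (Suc 0))))"
  shows "coprime_lower_central_factor p (Suc (Suc 0))"
proof (cases "p dvd card (rcosets (lower_central G (Suc (Suc 0))))")
  case False
  then have "coprime_lower_central_factor p (Suc 0)"
    using pow_card_rcosets_mem[OF lower_central_normal] lower_central_subset[of 0]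
    unfolding coprime_lower_central_factor_def
    by (intro exI[of _ "card (rcosets (lower_central G (Suc (Suc 0))))"] conjI ballI) blast+
  then show ?thesis by (rule coprime_lower_central_factor_step)
next
  case True
  then obtain m where m: "card (rcosets (lower_central G (Suc (Suc 0)))) = p * m" by blast
  then have pm: "\<not> p dvd m" using card by (auto simp: power2_eq_square)
  obtain t where t: "t \<in> carrier G" "\<And>x. x \<in> carrier G \<Longrightarrow>
      \<exists>k::nat. \<exists>g \<in> lower_central G (Suc (Suc 0)). x [^] m = g \<otimes> t [^] k"
    using powers_in_cyclic_mod_derived[OF p pm fin] m unfolding derived_carrier_eq by metis
  define N where "N = lower_central G (Suc (Suc (Suc 0)))"
  have N: "N \<lhd> G" unfolding N_def by (rule lower_central_normal)
  have G1: "x \<in> lower_central G (Suc 0)" if "x \<in> carrier G" for x using that by simp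
  have comm: "commutator (commutator a b) c \<in> N"
    if "a \<in> carrier G" "b \<in> carrier G" "c \<in> carrier G" for a b c
    unfolding N_def
    by (rule commutator_in_lower_central[OF commutator_in_lower_central[OF G1]]) (use that in auto)
  obtain Q :: "'a set monoid" and q where q: "group_hom G Q q"
    and ker: "\<And>x. x \<in> carrier G \<Longrightarrow> q x = \<one>\<^bsub>Q\<^esub> \<longleftrightarrow> x \<in> N"
    using normal_eq_kernel[OF N] by metis
  interpret q: group_hom G Q q by (rule q)
  have powers_commute: "commutator (x [^] m) (y [^] m) \<in> N"
    if x: "x \<in> carrier G" and y: "y \<in> carrier G" for x y
  proof -
    obtain i :: nat and g where g: "g \<in> lower_central G (Suc (Suc 0))" "x [^] m = g \<otimes> t [^] i"
      using t(2)[OF x] by blast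
    obtain j :: nat and h where h: "h \<in> lower_central G (Suc (Suc 0))" "y [^] m = h \<otimes> t [^] j"
      using t(2)[OF y] by blast
    have gh: "g \<in> carrier G" "h \<in> carrier G" using g h lower_central_subset by blast+
    have central: "q d \<otimes>\<^bsub>Q\<^esub> q z = q z \<otimes>\<^bsub>Q\<^esub> q d"
      if d: "d \<in> lower_central G (Suc (Suc 0))" and z: "z \<in> carrier G" for d z
    proof (rule q.images_commute)
      show dG: "d \<in> carrier G" using d lower_central_subset by blast
      show "q (commutator d z) = \<one>\<^bsub>Q\<^esub>"
        using commutator_in_lower_central[OF d z] dG z by (intro iffD2[OF ker]) (auto simp: N_def)
    qed (rule z)
    have "q (x [^] m) \<otimes>\<^bsub>Q\<^esub> q (y [^] m) = q (y [^] m) \<otimes>\<^bsub>Q\<^esub> q (x [^] m)"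
    proof -
      define T where "T = (\<lambda>i. q (t [^] (i::nat)))"
      have T: "T i \<otimes>\<^bsub>Q\<^esub> T j = T j \<otimes>\<^bsub>Q\<^esub> T i" "T k \<in> carrier Q" for i j k
        using t(1) by (simp_all add: T_def nat_pow_mult add.commute flip: q.hom_mult)
      have "q g \<otimes>\<^bsub>Q\<^esub> T i \<otimes>\<^bsub>Q\<^esub> (q h \<otimes>\<^bsub>Q\<^esub> T j) = q g \<otimes>\<^bsub>Q\<^esub> (T i \<otimes>\<^bsub>Q\<^esub> q h) \<otimes>\<^bsub>Q\<^esub> T j"
        using gh T(2) by (simp add: q.H.m_assoc)
      also have "T i \<otimes>\<^bsub>Q\<^esub> q h = q h \<otimes>\<^bsub>Q\<^esub> T i"
        using central[OF h(1), of "t [^] i"] t(1) by (simp add: T_def)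
      also have "q g \<otimes>\<^bsub>Q\<^esub> (q h \<otimes>\<^bsub>Q\<^esub> T i) \<otimes>\<^bsub>Q\<^esub> T j = (q g \<otimes>\<^bsub>Q\<^esub> q h) \<otimes>\<^bsub>Q\<^esub> (T i \<otimes>\<^bsub>Q\<^esub> T j)"
        using gh T(2) by (simp add: q.H.m_assoc)
      also have "q g \<otimes>\<^bsub>Q\<^esub> q h = q h \<otimes>\<^bsub>Q\<^esub> q g" by (rule central[OF g(1) gh(2)])
      also have "T i \<otimes>\<^bsub>Q\<^esub> T j = T j \<otimes>\<^bsub>Q\<^esub> T i" by (rule T(1))
      also have "(q h \<otimes>\<^bsub>Q\<^esub> q g) \<otimes>\<^bsub>Q\<^esub> (T j \<otimes>\<^bsub>Q\<^esub> T i) = q h \<otimes>\<^bsub>Q\<^esub> (q g \<otimes>\<^bsub>Q\<^esub> T j) \<otimes>\<^bsub>Q\<^esub> T i"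
        using gh T(2) by (simp add: q.H.m_assoc)
      also have "q g \<otimes>\<^bsub>Q\<^esub> T j = T j \<otimes>\<^bsub>Q\<^esub> q g"
        using central[OF g(1), of "t [^] j"] t(1) by (simp add: T_def)
      also have "q h \<otimes>\<^bsub>Q\<^esub> (T j \<otimes>\<^bsub>Q\<^esub> q g) \<otimes>\<^bsub>Q\<^esub> T i = (q h \<otimes>\<^bsub>Q\<^esub> T j) \<otimes>\<^bsub>Q\<^esub> (q g \<otimes>\<^bsub>Q\<^esub> T i)"
        using gh T(2) by (simp add: q.H.m_assoc)
      finally show ?thesis unfolding g(2) h(2) using gh t(1) by (simp add: T_def)
    qed
    then have "q.H.commutator (q (x [^] m)) (q (y [^] m)) = \<one>\<^bsub>Q\<^esub>"
      using x y by (intro q.H.commutator_eqI) auto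
    then have "q (commutator (x [^] m) (y [^] m)) = \<one>\<^bsub>Q\<^esub>"
      using x y by simp
    then show ?thesis by (rule iffD1[OF ker, rotated]) (use x y in simp)
  qed
  have "commutator x y [^] (m * m) \<in> N" if x: "x \<in> carrier G" and y: "y \<in> carrier G" for x y
  proof -
    have xm: "x [^] m \<in> carrier G" using x by simp
    have "commutator (x [^] m) y [^] m \<in> N"
      by (rule commutator_pow_mem_right[OF N xm y comm[OF xm y y] powers_commute[OF x y]])
    moreover have "q (commutator (x [^] m) y) = q (commutator x y [^] m)"
    proof -
      have "q (commutator x y) \<otimes>\<^bsub>Q\<^esub> q x = q x \<otimes>\<^bsub>Q\<^esub> q (commutator x y)"
        using comm[OF x y x] x y by (intro q.images_commute iffD2[OF ker]) simp_all
      then show ?thesis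
        using q.H.commutator_pow_left[of "q x" "q y" m] x y by (simp add: q.hom_nat_pow)
    qed
    ultimately have "q (commutator x y [^] m) [^]\<^bsub>Q\<^esub> m = \<one>\<^bsub>Q\<^esub>"
      using ker[of "commutator (x [^] m) y [^] m"] x y xm
      by (simp add: q.hom_nat_pow)
    then have "q (commutator x y [^] (m * m)) = \<one>\<^bsub>Q\<^esub>"
      using x y by (simp add: q.hom_nat_pow q.H.nat_pow_pow)
    then show ?thesis by (rule iffD1[OF ker, rotated]) (use x y in simp)
  qed
  then have "\<forall>x \<in> lower_central G (Suc (Suc 0)). x [^] (m * m) \<in> N"
    unfolding N_def using lower_central_pow_mem[of 0 "m * m"] by auto
  moreover have "\<not> p dvd m * m" using pm p prime_dvd_mult_iff by blast
  ultimately show ?thesis unfolding coprime_lower_central_factor_def N_def by blast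
qed

lemma index_not_dvd_imp_coprime:
  assumes "\<not> p dvd card (rcosets\<^bsub>G\<lparr>carrier := lower_central G (Suc i)\<rparr>\<^esub> lower_central G (Suc (Suc i)))"
  shows "coprime_lower_central_factor p (Suc i)"
proof -
  let ?L = "G\<lparr>carrier := lower_central G (Suc i)\<rparr>"
  have "lower_central G (Suc (Suc i)) \<lhd> ?L"
    by (rule normal_restrict_supergroup[OF lower_central_subgroup lower_central_normal lower_central_Suc_le])
  then have "x [^] card (rcosets\<^bsub>?L\<^esub> lower_central G (Suc (Suc i))) \<in> lower_central G (Suc (Suc i))"
    if "x \<in> lower_central G (Suc i)" for x
    using group.pow_card_rcosets_mem[OF subgroup_imp_group[OF lower_central_subgroup]] that
      nat_pow_consistent by fastforce
  with assms show ?thesis unfolding coprime_lower_central_factor_def by blast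
qed

lemma card_lower_central:
  "card (lower_central G (Suc i)) =
    card (rcosets\<^bsub>G\<lparr>carrier := lower_central G (Suc i)\<rparr>\<^esub> lower_central G (Suc (Suc i)))
      * card (lower_central G (Suc (Suc i)))"
proof -
  let ?L = "G\<lparr>carrier := lower_central G (Suc i)\<rparr>"
  have "subgroup (lower_central G (Suc (Suc i))) ?L"
    by (rule subgroup_incl[OF lower_central_subgroup lower_central_subgroup lower_central_Suc_le])
  from group.lagrange[OF subgroup_imp_group[OF lower_central_subgroup] this]
  show ?thesis by (simp add: order_def)
qed

text \<open>If one of the first factors had exponent prime to \<open>p\<close>, so would all later ones, and nilpotency
  would make some power of \<open>x\<close>, with exponent prime to \<open>p\<close>, trivial.\<close>

lemma prime_dvd_ord_imp_not_coprime_factor: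
  assumes nilp: "lower_central G (Suc c) = {\<one>}"
    and x: "x \<in> lower_central G (Suc l)" and p: "Factorial_Ring.prime p" "p dvd ord x" and "i \<le> l"
  shows "\<not> coprime_lower_central_factor p (Suc i)"
proof
  assume "coprime_lower_central_factor p (Suc i)"
  then have coprime: "coprime_lower_central_factor p (Suc j)" if "j \<ge> l" for j
    using coprime_lower_central_factor_mono that \<open>i \<le> l\<close> order_trans by blast
  have xG: "x \<in> carrier G" using x lower_central_subset by blast
  have "\<exists>m::nat. \<not> p dvd m \<and> x [^] m \<in> lower_central G (Suc (l + d))" for d
  proof (induction d)
    case 0
    have "\<not> p dvd 1" using p(1) not_prime_unit by blast
    moreover have "x [^] (1::nat) \<in> lower_central G (Suc (l + 0))" using x xG by simp
    ultimately show ?case by blast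
  next
    case (Suc d)
    then obtain m :: nat where m: "\<not> p dvd m" "x [^] m \<in> lower_central G (Suc (l + d))" by blast
    obtain k :: nat where k: "\<not> p dvd k"
      "\<And>y. y \<in> lower_central G (Suc (l + d)) \<Longrightarrow> y [^] k \<in> lower_central G (Suc (Suc (l + d)))"
      using coprime[of "l + d"] unfolding coprime_lower_central_factor_def by auto
    have "x [^] (m * k) \<in> lower_central G (Suc (l + Suc d))"
      using k(2)[OF m(2)] nat_pow_pow[OF xG, of m k] by (simp del: lower_central.simps)
    moreover have "\<not> p dvd m * k" using m(1) k(1) p(1) prime_dvd_mult_iff by blast
    ultimately show ?case by blast
  qed
  then obtain m :: nat where m: "\<not> p dvd m" "x [^] m \<in> lower_central G (Suc (l + c))" by blast
  have "x [^] m = \<one>" using lower_central_antimono[of c "l + c"] m(2) nilp by auto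
  then have "ord x dvd m" using pow_eq_id[OF xG] by blast
  with p(2) m(1) show False by (meson dvd_trans)
qed

text \<open>Each of the first \<open>l\<close> factors of the lower central series contributes a factor \<open>p\<close>,
  and the abelianization contributes two. For \<open>l = 1\<close> the bound would fail, as cyclic groups of
  order \<open>p\<close> show.\<close>

lemma prime_power_dvd_order:
  assumes fin: "finite (carrier G)" and nilp: "lower_central G (Suc c) = {\<one>}"
    and l: "l \<ge> 2" and x: "x \<in> lower_central G l" and p: "Factorial_Ring.prime p" "p dvd ord x"
  shows "p ^ (l + 1) dvd order G"
proof -
  obtain l' where l': "l = Suc l'" "l' \<ge> 1" using l by (cases l) auto
  have notcop: "\<not> coprime_lower_central_factor p (Suc i)" if "i \<le> l'" for i
    using prime_dvd_ord_imp_not_coprime_factor[OF nilp _ p that] x l'(1) by blast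
  have "p ^ (Suc j + 1) * card (lower_central G (Suc (Suc j))) dvd order G" if "j \<le> l'" for j
    using that
  proof (induction j)
    case 0
    have "p\<^sup>2 dvd card (rcosets (lower_central G (Suc (Suc 0))))"
      using coprime_second_lower_central_factor[OF p(1) fin] notcop[OF l'(2)] by auto
    then have "p\<^sup>2 * card (lower_central G (Suc (Suc 0))) dvd order G"
      unfolding lagrange[OF lower_central_subgroup[of "Suc 0"], symmetric] by (intro mult_dvd_mono) auto
    then show ?case by (simp add: power2_eq_square)
  next
    case (Suc j)
    let ?I = "card (rcosets\<^bsub>G\<lparr>carrier := lower_central G (Suc (Suc j))\<rparr>\<^esub> lower_central G (Suc (Suc (Suc j))))"
    have "p dvd ?I" using index_not_dvd_imp_coprime notcop[OF Suc.prems] by blast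
    then have "p ^ (Suc j + 1) * (p * card (lower_central G (Suc (Suc (Suc j)))))
        dvd p ^ (Suc j + 1) * (?I * card (lower_central G (Suc (Suc (Suc j)))))"
      by (intro mult_dvd_mono) auto
    also have "?I * card (lower_central G (Suc (Suc (Suc j)))) = card (lower_central G (Suc (Suc j)))"
      by (rule card_lower_central[symmetric])
    also have "p ^ (Suc j + 1) * card (lower_central G (Suc (Suc j))) dvd order G"
      using Suc by simp
    finally show ?case by (simp add: ac_simps)
  qed
  from dvd_mult_left[OF this[of l']] show ?thesis using l'(1) by simp
qed

text \<open>Only primes \<open>p \<le> n\<close> can divide the order of \<open>x\<close>, by the previous lemma, and the powers
  of these primes are bounded by the order of the group. The resulting exponent does not depend on
  the group, only on the bound for its order.\<close>

lemma lower_central_exponent: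
  assumes fin: "finite (carrier G)" and nilp: "lower_central G (Suc c) = {\<one>}"
    and l: "l \<ge> 2" and x: "x \<in> lower_central G l" and small: "order G < (n + 1) ^ (l + 1)"
  shows "x [^] (Lcm {1..n} ^ (2 * l + 1)) = \<one>"
proof -
  have xG: "x \<in> carrier G" using x lower_central_subset[of "l - 1"] l by (cases l) auto
  have ord0: "ord x \<noteq> 0" using ord_ge_1[OF fin xG] by simp
  have le: "d \<le> order G" if "d dvd order G" for d
    using that fin order_gt_0_iff_finite by (auto intro: dvd_imp_le)
  have "ord x dvd Lcm {1..n} ^ (2 * l + 1)"
  proof (rule dvd_if_prime_powers_dvd)
    fix p k :: nat assume p: "Factorial_Ring.prime p" and k: "p ^ k dvd ord x"
    show "p ^ k dvd Lcm {1..n} ^ (2 * l + 1)"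
    proof (cases "k = 0")
      case False
      then have "p dvd ord x" using k by (meson dvd_power dvd_trans neq0_conv)
      then have "p ^ (l + 1) < (n + 1) ^ (l + 1)"
        using le[OF prime_power_dvd_order[OF fin nilp l x p]] small by linarith
      then have "p < n + 1" by (rule power_less_imp_less_base) simp
      moreover have "p ^ k < (n + 1) ^ (l + 1)"
        using le[OF dvd_trans[OF k ord_dvd_group_order[OF xG]]] small by linarith
      ultimately show ?thesis using p by (intro prime_power_dvd_Lcm_power) auto
    qed simp
  qed (use ord0 in \<open>auto simp: Lcm_0_iff\<close>)
  then show ?thesis using pow_eq_id[OF xG] by blast
qed

lemma exp_of_derived_le_lower_central:
  "(derived G ^^ i) (carrier G) \<subseteq> lower_central G (Suc i)"
proof (induction i)
  case (Suc i)
  have "derived G ((derived G ^^ i) (carrier G)) \<subseteq> lower_central G (Suc (Suc i))"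
    unfolding derived_def[of G "(derived G ^^ i) (carrier G)"] lower_central.simps commutator_subgroup_def
    by (intro mono_generate UN_mono Suc.IH exp_of_derived_in_carrier subset_refl)
  then show ?case by simp
qed simp

end

lemma (in group_hom) lower_central_img:
  assumes "h ` carrier G = carrier H"
  shows "lower_central H (Suc i) = h ` lower_central G (Suc i)"
proof (induction i)
  case (Suc i)
  have sub: "lower_central G (Suc i) \<subseteq> carrier G" by (rule G.lower_central_subset)
  have gens: "(\<Union>a\<in>h ` lower_central G (Suc i). \<Union>b\<in>h ` carrier G. {H.commutator a b})
      = h ` (\<Union>a\<in>lower_central G (Suc i). \<Union>b\<in>carrier G. {G.commutator a b})"
  proof -
    have "H.commutator (h a) (h b) = h (G.commutator a b)"
      if "a \<in> lower_central G (Suc i)" "b \<in> carrier G" for a b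
      using hom_commutator[of a b] that sub by auto
    then show ?thesis unfolding image_UN UN_simps by simp
  qed
  have gens_carrier: "(\<Union>a\<in>lower_central G (Suc i). \<Union>b\<in>carrier G. {G.commutator a b}) \<subseteq> carrier G"
    using sub by auto
  show ?case
    unfolding lower_central.simps commutator_subgroup_def Suc.IH assms[symmetric] gens
    by (rule generate_img[OF gens_carrier])
qed (use assms in simp)

section \<open>Groups of finite rank and bounded exponent\<close>

text \<open>Pruefer rank at most \<open>\<rho>\<close>, expressed by generating sets in the ambient group, which is the form that
  passes to quotients and can be used inside subgroups.\<close>

definition rank_at_most :: "('a, 'b) monoid_scheme \<Rightarrow> nat \<Rightarrow> bool" where
  "rank_at_most G \<rho> \<longleftrightarrow> (\<forall>S. finite S \<and> S \<subseteq> carrier G \<longrightarrow>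
     (\<exists>T. finite T \<and> T \<subseteq> carrier G \<and> card T \<le> \<rho> \<and> generate G T = generate G S))"

lemma rank_at_mostE:
  assumes "rank_at_most G \<rho>" "finite S" "S \<subseteq> carrier G"
  obtains T where "finite T" "T \<subseteq> carrier G" "card T \<le> \<rho>" "generate G T = generate G S"
  using assms(1)[unfolded rank_at_most_def, rule_format, OF conjI[OF assms(2,3)]] that by auto

lemma (in group) finite_pruefer_rank:
  assumes "pruefer_rank G < \<infinity>"
  obtains \<rho> where "rank_at_most G \<rho>"
proof -
  obtain \<rho> where \<rho>: "pruefer_rank G \<le> enat \<rho>" using assms by (cases "pruefer_rank G") auto
  have "\<exists>T. finite T \<and> T \<subseteq> carrier G \<and> card T \<le> \<rho> \<and> generate G T = generate G S"
    if S: "finite S" "S \<subseteq> carrier G" for S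
  proof -
    let ?H = "G\<lparr>carrier := generate G S\<rparr>"
    have H: "subgroup (generate G S) G" by (rule generate_is_subgroup[OF S(2)])
    have "finite_generating_set ?H S"
      using S generate_consistent[OF _ H, of S] generate.incl[of _ S G]
      unfolding finite_generating_set_def by auto
    then obtain T where T: "finite_generating_set ?H T" "card T \<le> \<rho>"
      using \<rho> H unfolding pruefer_rank_le_iff finitely_generated_def by auto
    then have "T \<subseteq> generate G S" "finite T" "generate ?H T = generate G S"
      unfolding finite_generating_set_def by auto
    then show ?thesis
      using T(2) generate_consistent[OF _ H, of T] generate_incl[OF S(2)] by blast
  qed
  then have "rank_at_most G \<rho>" unfolding rank_at_most_def by blast
  then show ?thesis by (rule that)
qed

lemma (in group_hom) rank_at_most_img:
  assumes "rank_at_most G \<rho>" "h ` carrier G = carrier H"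
  shows "rank_at_most H \<rho>"
  unfolding rank_at_most_def
proof (intro allI impI, elim conjE)
  fix S assume S: "finite S" "S \<subseteq> carrier H"
  then obtain S' where S': "S' \<subseteq> carrier G" "finite S'" "S = h ` S'"
    using assms(2) by (metis finite_subset_image)
  obtain T where T: "finite T" "T \<subseteq> carrier G" "card T \<le> \<rho>" "generate G T = generate G S'"
    by (rule rank_at_mostE[OF assms(1) S'(2,1)])
  have "generate H (h ` T) = generate H S"
    using generate_img[OF T(2)] generate_img[OF S'(1)] T(4) S'(3) by metis
  moreover have "card (h ` T) \<le> \<rho>" using card_image_le[OF T(1), of h] T(3) by linarith
  moreover have "h ` T \<subseteq> carrier H" using T(2) by auto
  ultimately show "\<exists>T. finite T \<and> T \<subseteq> carrier H \<and> card T \<le> \<rho> \<and> generate H T = generate H S"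
    using T(1) by blast
qed

lemma (in comm_group) generate_insert_subset:
  assumes t: "t \<in> carrier G" and T: "T \<subseteq> carrier G" and E: "E > 0" "t [^] (E::nat) = \<one>"
  shows "generate G (insert t T) \<subseteq> (\<lambda>(i, h). t [^] i \<otimes> h) ` ({..<E} \<times> generate G T)"
proof -
  have mod: "t [^] i = t [^] (i mod E)" for i :: nat
  proof -
    have "t [^] i = t [^] (E * (i div E) + i mod E)" by simp
    also have "\<dots> = (t [^] E) [^] (i div E) \<otimes> t [^] (i mod E)"
      by (simp only: nat_pow_mult[OF t, symmetric] nat_pow_pow[OF t])
    finally show ?thesis using E(2) t by simp
  qed
  have car: "h \<in> carrier G" if "h \<in> generate G T" for h
    using generate_in_carrier[OF T that] .
  have power_times: "\<exists>i::nat. \<exists>h \<in> generate G T. x = t [^] i \<otimes> h" if "x \<in> generate G (insert t T)" for x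
    using that
  proof induction
    case one
    show ?case by (intro exI[of _ 0] bexI[of _ \<one>]) (auto intro: generate.one)
  next
    case (incl x)
    show ?case
    proof (cases "x = t")
      case True
      then show ?thesis using t by (intro exI[of _ 1] bexI[of _ \<one>]) (auto intro: generate.one)
    next
      case False
      then show ?thesis using incl T
        by (intro exI[of _ 0] bexI[of _ x]) (auto intro: generate.incl)
    qed
  next
    case (inv x)
    show ?case
    proof (cases "x = t")
      case True
      have "t [^] (E - 1) \<otimes> t = \<one>"
        using E nat_pow_Suc[of t "E - 1"] by simp
      then have "inv t = t [^] (E - 1)" using t by (intro inv_equality) auto
      then show ?thesis using t True
        by (intro exI[of _ "E - 1"] bexI[of _ \<one>]) (auto intro: generate.one)
    next
      case False
      then show ?thesis using inv T
        by (intro exI[of _ 0] bexI[of _ "inv x"]) (auto intro: generate.inv)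
    qed
  next
    case (eng x y)
    then obtain i j :: nat and g h where g: "g \<in> generate G T" "x = t [^] i \<otimes> g"
      and h: "h \<in> generate G T" "y = t [^] j \<otimes> h" by blast
    have "x \<otimes> y = t [^] (i + j) \<otimes> (g \<otimes> h)"
      using car[OF g(1)] car[OF h(1)] t unfolding g(2) h(2)
      by (simp add: nat_pow_mult[symmetric] m_ac)
    then show ?case using generate.eng[OF g(1) h(1)] by blast
  qed
  show ?thesis
  proof
    fix x assume "x \<in> generate G (insert t T)"
    then obtain i :: nat and h where h: "h \<in> generate G T" "x = t [^] i \<otimes> h"
      using power_times by blast
    show "x \<in> (\<lambda>(i, h). t [^] i \<otimes> h) ` ({..<E} \<times> generate G T)"
      by (rule image_eqI[of _ _ "(i mod E, h)"]) (use h mod[of i] E(1) in auto)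
  qed
qed

text \<open>Collecting exponents: every element is a product of one power of each generator, with exponents
  below \<open>E\<close>.\<close>

lemma (in comm_group) card_generate_le_exponent_power:
  assumes "finite T" "T \<subseteq> carrier G" "E > 0" "\<And>x. x \<in> carrier G \<Longrightarrow> x [^] (E::nat) = \<one>"
  shows "finite (generate G T) \<and> card (generate G T) \<le> E ^ card T"
  using assms(1,2)
proof (induction T)
  case empty
  show ?case by (simp add: generate_empty)
next
  case (insert t T)
  then have IH: "finite (generate G T)" "card (generate G T) \<le> E ^ card T" by auto
  let ?f = "\<lambda>(i, h). t [^] (i::nat) \<otimes> h" and ?A = "{..<E} \<times> generate G T"
  have sub: "generate G (insert t T) \<subseteq> ?f ` ?A"
    using insert.prems assms(3,4) by (intro generate_insert_subset) auto
  have fin: "finite ?A" using IH by simp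
  have "card (generate G (insert t T)) \<le> card ?A"
    using card_mono[OF finite_imageI[OF fin] sub] card_image_le[OF fin, of ?f] by linarith
  also have "\<dots> \<le> E ^ card (insert t T)"
    using IH insert.hyps by (simp add: card_cartesian_product)
  finally show ?case using finite_subset[OF sub finite_imageI[OF fin]] by blast
qed

text \<open>Each factor of the derived series is abelian of exponent dividing \<open>E\<close> with all finitely
  generated subgroups on at most \<open>\<rho>\<close> generators, hence has at most \<open>E^\<rho>\<close> elements.
  The bound is obtained for finite subsets of a factor, which also gives its finiteness.\<close>

lemma (in group) card_solvable_bounded_exponent:
  assumes "subgroup H G" "(derived G ^^ n) H = {\<one>}" "rank_at_most G \<rho>"
    and "E > 0" "\<And>x. x \<in> H \<Longrightarrow> x [^] (E::nat) = \<one>"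
  shows "finite H \<and> card H \<le> E ^ (\<rho> * n)"
  using assms(1,2,5)
proof (induction n arbitrary: H)
  case 0
  then show ?case by simp
next
  case (Suc n)
  note H = Suc.prems(1)
  define D where "D = derived G H"
  define P where "P = G\<lparr>carrier := H\<rparr>"
  define A where "A = P Mod D"
  have DH: "D \<subseteq> H" unfolding D_def by (rule derived_incl[OF subset_refl H])
  have D: "subgroup D G" unfolding D_def by (rule derived_is_subgroup[OF subgroup.subset[OF H]])
  have DP: "D \<lhd> P" unfolding D_def P_def by (rule derived_subgroup_is_normal[OF H])
  have IH: "finite D \<and> card D \<le> E ^ (\<rho> * n)"
  proof (rule Suc.IH[OF D])
    show "(derived G ^^ n) D = {\<one>}" using Suc.prems(2) by (simp add: D_def funpow_swap1)
    show "x [^] E = \<one>" if "x \<in> D" for x using Suc.prems(3) DH that by blast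
  qed
  interpret P: group P unfolding P_def by (rule subgroup_imp_group[OF H])
  interpret A: comm_group A unfolding A_def P_def D_def by (rule derived_quot_of_subgroup_is_comm_group[OF H])
  interpret q: group_hom P A "\<lambda>x. D #>\<^bsub>P\<^esub> x" unfolding A_def by (rule P.quotient_map_hom[OF DP])
  let ?q = "\<lambda>x. D #>\<^bsub>P\<^esub> x"
  have surj: "carrier A = ?q ` H" unfolding A_def P_def FactGroup_def RCOSETS_def by auto
  have expq: "(?q x) [^]\<^bsub>A\<^esub> E = \<one>\<^bsub>A\<^esub>" if x: "x \<in> H" for x
  proof -
    have xP: "x \<in> carrier P" using x by (simp add: P_def)
    have xE: "x [^]\<^bsub>P\<^esub> E = \<one>\<^bsub>P\<^esub>"
      using Suc.prems(3)[OF x] nat_pow_consistent[of x E H] by (simp add: P_def)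
    have "(?q x) [^]\<^bsub>A\<^esub> E = ?q (x [^]\<^bsub>P\<^esub> E)" by (rule q.hom_nat_pow[OF xP, symmetric])
    also have "\<dots> = \<one>\<^bsub>A\<^esub>" unfolding xE by (rule q.hom_one)
    finally show ?thesis .
  qed
  have expA: "Y [^]\<^bsub>A\<^esub> E = \<one>\<^bsub>A\<^esub>" if "Y \<in> carrier A" for Y
    using that[unfolded surj] by (rule imageE) (simp only: expq)
  have "card Y \<le> E ^ \<rho>" if Y: "Y \<subseteq> carrier A" "finite Y" for Y
  proof -
    obtain S where S: "S \<subseteq> H" "finite S" "Y = ?q ` S"
      using finite_subset_image[OF Y(2)] Y(1) surj by metis
    have SG: "S \<subseteq> carrier G" using S(1) subgroup.subset[OF H] by blast
    obtain T where T: "finite T" "T \<subseteq> carrier G" "card T \<le> \<rho>" "generate G T = generate G S"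
      by (rule rank_at_mostE[OF assms(3) S(2) SG])
    have TH: "T \<subseteq> H"
      using T(4) generate_subgroup_incl[OF S(1) H] generate.incl[of _ T G] by blast
    have gen: "generate P T = generate P S"
      unfolding P_def using T(4) generate_consistent[OF TH H] generate_consistent[OF S(1) H] by simp
    have "Y \<subseteq> ?q ` generate P S" unfolding S(3) by (intro image_mono subsetI generate.incl)
    also have "\<dots> = generate A (?q ` T)"
      unfolding gen[symmetric] by (rule q.generate_img[symmetric]) (use TH in \<open>simp add: P_def\<close>)
    finally have XT: "Y \<subseteq> generate A (?q ` T)" .
    have "?q ` T \<subseteq> carrier A" unfolding surj using TH by blast
    then have fin: "finite (generate A (?q ` T))" and c: "card (generate A (?q ` T)) \<le> E ^ card (?q ` T)"
      using A.card_generate_le_exponent_power[of "?q ` T" E] T(1) assms(4) expA by auto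
    have "card Y \<le> E ^ card (?q ` T)" using card_mono[OF fin XT] c by linarith
    also have "\<dots> \<le> E ^ \<rho>"
      using card_image_le[OF T(1), of ?q] T(3) assms(4) by (intro power_increasing) auto
    finally show ?thesis .
  qed
  then have finA: "finite (carrier A)" and cardA: "card (carrier A) \<le> E ^ \<rho>"
    using finite_if_finite_subsets_card_bdd[of "carrier A" "E ^ \<rho>"] by auto
  have cardH: "card (carrier A) * card D = card H"
    using P.lagrange[OF normal_imp_subgroup[OF DP]] by (simp add: A_def FactGroup_def order_def P_def)
  have "card (carrier A) > 0" using finA A.one_closed by (auto simp: card_gt_0_iff)
  moreover have "card D > 0" using IH subgroup.one_closed[OF D] by (auto simp: card_gt_0_iff)
  ultimately have "finite H" using cardH by (metis card_ge_0_finite nat_0_less_mult_iff)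
  moreover have "card H \<le> E ^ (\<rho> * Suc n)"
    using mult_mono[OF cardA conjunct2[OF IH]] cardH by (simp add: power_add)
  ultimately show ?case by blast
qed

section \<open>Elements in all normal subgroups of small index\<close>

context group
begin

text \<open>Through this image, lower bounds for the order of a finite nilpotent group become lower bounds
  for the index of \<open>N\<close>.\<close>

lemma quotient_image:
  assumes N: "N \<lhd> G" and K: "subgroup K G"
  obtains P :: "'a set monoid" and q
  where "group_hom (G\<lparr>carrier := K\<rparr>) P q" "q ` K = carrier P"
    "\<And>x. x \<in> K \<Longrightarrow> q x = \<one>\<^bsub>P\<^esub> \<longleftrightarrow> x \<in> N"
    "finite (rcosets N) \<Longrightarrow> finite (carrier P) \<and> order P \<le> card (rcosets N)"
proof -
  interpret q: group_hom G "G Mod N" "\<lambda>x. N #> x" by (rule quotient_map_hom[OF N])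
  let ?q = "\<lambda>x. N #> x" and ?P = "(G Mod N)\<lparr>carrier := (\<lambda>x. N #> x) ` K\<rparr>"
  have KG: "K \<subseteq> carrier G" by (rule subgroup.subset[OF K])
  have sub: "?q ` K \<subseteq> rcosets N" using KG by (auto simp: RCOSETS_def)
  show ?thesis
  proof (rule that)
    show "group_hom (G\<lparr>carrier := K\<rparr>) ?P ?q" by (rule q.induced_group_hom[OF K])
    show "?q ` K = carrier ?P" by simp
    show "?q x = \<one>\<^bsub>?P\<^esub> \<longleftrightarrow> x \<in> N" if "x \<in> K" for x
      using quotient_map_eq_one_iff[OF N, of x] that KG by auto
    show "finite (carrier ?P) \<and> order ?P \<le> card (rcosets N)" if "finite (rcosets N)"
      using finite_subset[OF sub that] card_mono[OF that sub] by (simp add: order_def)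
  qed
qed

text \<open>Nontrivial elements of this set are the witnesses for a lower bound \<open>B\<close> on residual finiteness growth.\<close>

definition small_index_core :: "nat \<Rightarrow> 'a set" where
  "small_index_core B =
    {g \<in> carrier G. \<forall>N. N \<lhd> G \<longrightarrow> finite (rcosets N) \<longrightarrow> card (rcosets N) < B \<longrightarrow> g \<in> N}"

lemma small_index_core_normal: "small_index_core B \<lhd> G"
proof (rule normal_invI)
  show "subgroup (small_index_core B) G"
    by (rule subgroupI)
      (auto simp: small_index_core_def subgroup.m_closed subgroup.m_inv_closed
         subgroup.one_closed normal_imp_subgroup intro!: exI[of _ "\<one>"])
  show "x \<otimes> h \<otimes> inv x \<in> small_index_core B"
    if "x \<in> carrier G" "h \<in> small_index_core B" for x h
    using that by (auto simp: small_index_core_def normal_invE(2))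
qed

lemma RF_depth_ge_small_index_core:
  assumes "g \<in> small_index_core B"
  shows "enat B \<le> RF_depth G g"
  unfolding RF_depth_def
proof (rule INF_greatest)
  fix N assume N: "N \<in> {N. N \<lhd> G \<and> g \<notin> N}"
  show "enat B \<le> subgroup_index G N"
  proof (cases "finite (rcosets N)")
    case True
    then have "\<not> card (rcosets N) < B" using N assms unfolding small_index_core_def by auto
    then show ?thesis using True by (simp add: subgroup_index_def)
  qed (simp add: subgroup_index_def)
qed

lemma word_inverse:
  assumes S: "S \<subseteq> carrier G" and ws: "is_word G S ws"
  shows "\<exists>vs. is_word G S vs \<and> length vs = length ws \<and> word_value G vs = inv (word_value G ws)"
  using ws
proof (induction ws)
  case Nil
  show ?case by (rule exI[of _ "[]"]) (simp add: is_word_def word_value_def)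
next
  case (Cons a ws)
  then have ws: "is_word G S ws" and a: "a \<in> S \<union> set_inv S" by (auto simp: is_word_def)
  have aG: "a \<in> carrier G" using a S by (auto simp: SET_INV_def)
  have inva: "inv a \<in> S \<union> set_inv S" using a S by (auto simp: SET_INV_def)
  obtain vs where vs: "is_word G S vs" "length vs = length ws" "word_value G vs = inv (word_value G ws)"
    using Cons.IH[OF ws] by blast
  have wa: "is_word G S [inv a]" using inva by (simp add: is_word_def)
  have "word_value G (vs @ [inv a]) = inv (word_value G ws) \<otimes> inv a"
    using word_value_append[OF S vs(1) wa] vs(3) aG by (simp add: word_value_def)
  also have "\<dots> = inv (word_value G (a # ws))"
    using aG word_value_closed[OF S ws] by (simp add: word_value_def inv_mult_group)
  finally show ?case using vs(1,2) inva
    by (intro exI[of _ "vs @ [inv a]"]) (auto simp: is_word_def)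
qed

lemma word_ball_div:
  assumes S: "finite_generating_set G S" and x: "x \<in> word_ball G S r" and y: "y \<in> word_ball G S r"
  shows "x \<otimes> inv y \<in> word_ball G S (2 * r)"
proof -
  have SG: "S \<subseteq> carrier G" using S by (simp add: finite_generating_set_def)
  obtain us where us: "is_word G S us" "word_value G us = x" "real (length us) \<le> r"
    using x unfolding word_ball_eq[OF S] by blast
  obtain ws where ws: "is_word G S ws" "word_value G ws = y" "real (length ws) \<le> r"
    using y unfolding word_ball_eq[OF S] by blast
  obtain vs where vs: "is_word G S vs" "length vs = length ws" "word_value G vs = inv y"
    using word_inverse[OF SG ws(1)] ws(2) by blast
  have "word_value G (us @ vs) = x \<otimes> inv y"
    using word_value_append[OF SG us(1) vs(1)] us(2) vs(3) by simp
  moreover have "is_word G S (us @ vs)" using us(1) vs(1) by (simp add: is_word_def)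
  moreover have "real (length (us @ vs)) \<le> 2 * r" using us(3) ws(3) vs(2) by simp
  ultimately show ?thesis
    unfolding word_ball_eq[OF S] by (intro CollectI exI[of _ "us @ vs"] conjI) simp_all
qed

text \<open>The exponent bound holds in every quotient of small order with one and the same exponent, so the
  powers land in all the corresponding normal subgroups at once.\<close>

lemma lower_central_power_in_small_index_core:
  assumes K: "subgroup K G" and nilp: "lower_central (G\<lparr>carrier := K\<rparr>) (Suc c) = {\<one>}"
    and l: "l \<ge> 2" and x: "x \<in> lower_central (G\<lparr>carrier := K\<rparr>) l"
  shows "x [^] (Lcm {1..n} ^ (2 * l + 1)) \<in> small_index_core ((n + 1) ^ (l + 1))"
proof -
  let ?K = "G\<lparr>carrier := K\<rparr>" and ?E = "Lcm {1..n} ^ (2 * l + 1) :: nat"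
  interpret K: group ?K by (rule subgroup_imp_group[OF K])
  obtain l' where l': "l = Suc l'" using l by (cases l) auto
  have xK: "x \<in> K" using x K.lower_central_subset[of l'] by (auto simp: l')
  have xE: "x [^] ?E \<in> K" 
    using K.nat_pow_closed[of x ?E] xK nat_pow_consistent[of x ?E K] by simp
  have "x [^] ?E \<in> N" if N: "N \<lhd> G" "finite (rcosets N)" "card (rcosets N) < (n + 1) ^ (l + 1)" for N
  proof -
    obtain P :: "'a set monoid" and q where q: "group_hom ?K P q" "q ` K = carrier P"
      and ker: "\<And>x. x \<in> K \<Longrightarrow> q x = \<one>\<^bsub>P\<^esub> \<longleftrightarrow> x \<in> N"
      and card: "finite (carrier P)" "order P \<le> card (rcosets N)"
      by (rule quotient_image[OF N(1) K]) (use N(2) in blast)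
    interpret q: group_hom ?K P q by (rule q(1))
    have lc: "lower_central P (Suc i) = q ` lower_central ?K (Suc i)" for i
      using q.lower_central_img q(2) by simp
    have "lower_central P (Suc c) = {\<one>\<^bsub>P\<^esub>}"
      using lc[of c] nilp q.hom_one by simp
    moreover have "q x \<in> lower_central P l" using x lc[of l'] unfolding l' by blast
    ultimately have "q x [^]\<^bsub>P\<^esub> ?E = \<one>\<^bsub>P\<^esub>"
      using card N(3) by (intro q.H.lower_central_exponent[OF _ _ l]) auto
    then have "q (x [^] ?E) = \<one>\<^bsub>P\<^esub>"
      using q.hom_nat_pow[of x ?E] xK nat_pow_consistent[of x ?E K] by simp
    then show ?thesis using ker[OF xE] by blast
  qed
  moreover have "x [^] ?E \<in> carrier G" using xE subgroup.subset[OF K] by blast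
  ultimately show ?thesis unfolding small_index_core_def by blast
qed

text \<open>The image of the term of the lower central series in the quotient by \<open>J\<close> is solvable of finite
  rank, with exponent dividing \<open>E\<close>, and therefore has fewer elements than \<open>A\<close>.\<close>

lemma pigeonhole_in_lower_central:
  assumes K: "subgroup K G" and nilp: "lower_central (G\<lparr>carrier := K\<rparr>) (Suc c) = {\<one>}"
    and rank: "rank_at_most (G\<lparr>carrier := K\<rparr>) \<rho>"
    and J: "J \<lhd> G" and E: "E > 0"
    and pow: "\<And>x. x \<in> lower_central (G\<lparr>carrier := K\<rparr>) (Suc l) \<Longrightarrow> x [^] (E::nat) \<in> J"
    and A: "A \<subseteq> lower_central (G\<lparr>carrier := K\<rparr>) (Suc l)" "E ^ (\<rho> * c) < card A"
  obtains x y where "x \<in> A" "y \<in> A" "x \<noteq> y" "x \<otimes> inv y \<in> J"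
proof -
  let ?K = "G\<lparr>carrier := K\<rparr>"
  interpret K: group ?K by (rule subgroup_imp_group[OF K])
  obtain P :: "'a set monoid" and q where q: "group_hom ?K P q" "q ` K = carrier P"
    and ker: "\<And>x. x \<in> K \<Longrightarrow> q x = \<one>\<^bsub>P\<^esub> \<longleftrightarrow> x \<in> J"
    by (rule quotient_image[OF J K]) blast
  interpret q: group_hom ?K P q by (rule q(1))
  have surj: "q ` carrier ?K = carrier P" using q(2) by simp
  have lc: "lower_central P (Suc i) = q ` lower_central ?K (Suc i)" for i
    by (rule q.lower_central_img[OF surj])
  let ?H = "lower_central P (Suc l)"
  have LK: "lower_central ?K (Suc l) \<subseteq> K" using K.lower_central_subset[of l] by simp
  have AK: "A \<subseteq> K" using A(1) LK by blast
  have H: "subgroup ?H P" by (rule q.H.lower_central_subgroup)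
  have "(derived P ^^ c) ?H \<subseteq> (derived P ^^ c) (carrier P)"
    by (rule q.H.mono_exp_of_derived[OF subgroup.subset[OF H]])
  also have "\<dots> \<subseteq> lower_central P (Suc c)" by (rule q.H.exp_of_derived_le_lower_central)
  also have "\<dots> = {\<one>\<^bsub>P\<^esub>}" unfolding lc nilp using q.hom_one by simp
  finally have "(derived P ^^ c) ?H = {\<one>\<^bsub>P\<^esub>}"
    using subgroup.one_closed[OF q.H.exp_of_derived_is_subgroup[OF H, of c]] by blast
  moreover have "rank_at_most P \<rho>" by (rule q.rank_at_most_img[OF rank surj])
  moreover have "y [^]\<^bsub>P\<^esub> E = \<one>\<^bsub>P\<^esub>" if "y \<in> ?H" for y
  proof -
    obtain x where x: "x \<in> lower_central ?K (Suc l)" "y = q x" using \<open>y \<in> ?H\<close> unfolding lc by blast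
    have xK: "x \<in> K" using x(1) LK by blast
    have xE: "x [^]\<^bsub>?K\<^esub> E = x [^] E" by (rule nat_pow_consistent[symmetric])
    have "x [^] E \<in> K" using K.nat_pow_closed[of x E] xK xE by simp
    then have "q (x [^] E) = \<one>\<^bsub>P\<^esub>" using ker pow[OF x(1)] by blast
    then show ?thesis unfolding x(2) using q.hom_nat_pow[of x E] xK xE by simp
  qed
  ultimately have card: "finite ?H \<and> card ?H \<le> E ^ (\<rho> * c)"
    using E by (intro q.H.card_solvable_bounded_exponent[OF H])
  have sub: "q ` A \<subseteq> ?H" unfolding lc using A(1) by (rule image_mono)
  have "card (q ` A) < card A"
    using card_mono[OF conjunct1[OF card] sub] card A(2) by linarith
  then have "\<not> inj_on q A" using card_image by force
  then obtain x y where xy: "x \<in> A" "y \<in> A" "x \<noteq> y" "q x = q y" unfolding inj_on_def by blast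
  have xyK: "x \<in> K" "y \<in> K" using xy AK by auto
  have invy: "inv\<^bsub>?K\<^esub> y = inv y" by (rule m_inv_consistent[OF K xyK(2)])
  have "q (x \<otimes>\<^bsub>?K\<^esub> inv\<^bsub>?K\<^esub> y) = \<one>\<^bsub>P\<^esub>"
    using xyK xy(4) q.hom_mult[of x "inv\<^bsub>?K\<^esub> y"] q.hom_inv[of y] q.hom_closed[of y] K.inv_closed[of y]
      q.H.r_inv[of "q y"] by simp
  then have "q (x \<otimes> inv y) = \<one>\<^bsub>P\<^esub>" using invy by simp
  moreover have "x \<otimes> inv y \<in> K" using xyK K by (simp add: subgroup.m_closed subgroup.m_inv_closed)
  ultimately have "x \<otimes> inv y \<in> J" using ker by blast
  with xy show ?thesis using that by blast
qed

lemma RF_growth_ge_if_many_short_elements: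
  assumes S: "finite_generating_set G S" and K: "subgroup K G"
    and nilp: "lower_central (G\<lparr>carrier := K\<rparr>) (Suc c) = {\<one>}"
    and rank: "rank_at_most (G\<lparr>carrier := K\<rparr>) \<rho>" and l: "l \<ge> 2"
    and many: "Lcm {1..n} ^ ((2 * l + 1) * (\<rho> * c))
      < card (word_ball G S r \<inter> lower_central (G\<lparr>carrier := K\<rparr>) l)"
  shows "enat ((n + 1) ^ (l + 1)) \<le> RF_growth G S (2 * r)"
proof -
  let ?L = "lower_central (G\<lparr>carrier := K\<rparr>)" and ?J = "small_index_core ((n + 1) ^ (l + 1))"
  let ?E = "Lcm {1..n} ^ (2 * l + 1) :: nat"
  obtain l' where l': "l = Suc l'" using l by (cases l) auto
  have "Lcm {1..n} \<noteq> 0" by (simp add: Lcm_0_iff)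
  then have E: "?E > 0" by (intro zero_less_power) blast
  have pow: "x [^] ?E \<in> ?J" if "x \<in> ?L (Suc l')" for x
    using lower_central_power_in_small_index_core[OF K nilp l] that unfolding l' by blast
  obtain x y where xy: "x \<in> word_ball G S r \<inter> ?L l" "y \<in> word_ball G S r \<inter> ?L l" "x \<noteq> y"
      "x \<otimes> inv y \<in> ?J"
  proof (rule pigeonhole_in_lower_central[OF K nilp rank small_index_core_normal E pow])
    show "word_ball G S r \<inter> ?L l \<subseteq> ?L (Suc l')" unfolding l' by blast
    show "?E ^ (\<rho> * c) < card (word_ball G S r \<inter> ?L l)" using many by (simp only: power_mult[of _ "2 * l + 1"])
  qed
  have G: "x \<in> carrier G" "y \<in> carrier G" using xy(1,2) by (auto simp: word_ball_def)
  have "x \<otimes> inv y \<noteq> \<one>" using G xy(3) inv_equality[of x "inv y"] by auto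
  moreover have "x \<otimes> inv y \<in> word_ball G S (2 * r)" using xy by (intro word_ball_div[OF S]) auto
  ultimately have "RF_depth G (x \<otimes> inv y) \<le> RF_growth G S (2 * r)"
    unfolding RF_growth_def by (intro SUP_upper) auto
  then show ?thesis using RF_depth_ge_small_index_core[OF xy(4)] by (rule order_trans[rotated])
qed

end

lemma ex_power2_between:
  fixes x :: real
  assumes "x \<ge> 1"
  obtains k where "x \<le> 2 ^ k" "2 ^ k \<le> 2 * x"
proof -
  define m where "m = nat \<lfloor>x\<rfloor>"
  have m: "real m \<le> x" "x < real m + 1" "m \<ge> 1"
    using assms unfolding m_def by (auto simp: le_nat_iff le_floor_iff)
  obtain k where k: "2 ^ k \<le> m" "m < 2 ^ (k + 1)" using ex_power_ivl1[of 2 m] m(3) by auto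
  have "real (m + 1) \<le> real (2 ^ (k + 1))" using k(2) by (simp only: of_nat_le_iff)
  then have "x \<le> 2 ^ (k + 1)" using m(2) by simp
  moreover have "real (2 ^ k) \<le> real m" using k(1) by (simp only: of_nat_le_iff)
  then have "2 ^ (k + 1) \<le> 2 * x" using order_trans[OF _ m(1), of "real (2 ^ k)"] by simp
  ultimately show ?thesis by (rule that)
qed

theorem theorem7p3:
  fixes G :: "('a, 'b) monoid_scheme" (structure)
    and K S :: "'a set" and l :: nat and C\<^sub>1 C\<^sub>2 :: real
  assumes "M_group G"
    and "K \<lhd> G"
    and "torsion_free (G\<lparr>carrier := K\<rparr>)"
    and "nilpotent_group (G\<lparr>carrier := K\<rparr>)"
    and "pruefer_rank (G\<lparr>carrier := K\<rparr>) < \<infinity>"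
    and "virtually_abelian (G Mod K)"
    and "finite_generating_set G S"
    and "C\<^sub>1 > 1" and "C\<^sub>2 > 1" and "l > 1"
    and "\<forall>\<^sub>F r in at_top.
           C\<^sub>1 powr r \<le> real (card (word_ball G S (C\<^sub>2 * r) \<inter> lower_central (G\<lparr>carrier := K\<rparr>) l))"
  shows "(\<lambda>r. ennreal (r ^ (l + 1))) \<preceq> (\<lambda>r. ennreal_of_enat (RF_growth G S r))"
proof -
  interpret group G using assms(1) by (simp add: M_group_def)
  have K: "subgroup K G" by (rule normal_imp_subgroup[OF assms(2)])
  interpret K: group "G\<lparr>carrier := K\<rparr>" by (rule subgroup_imp_group[OF K])
  obtain c where c: "lower_central (G\<lparr>carrier := K\<rparr>) (Suc c) = {\<one>}"
    using assms(4) by (auto simp: nilpotent_group_def)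
  obtain \<rho> where \<rho>: "rank_at_most (G\<lparr>carrier := K\<rparr>) \<rho>" by (rule K.finite_pruefer_rank[OF assms(5)])
  obtain r0 where r0: "\<And>r. r \<ge> r0 \<Longrightarrow>
      C\<^sub>1 powr r \<le> real (card (word_ball G S (C\<^sub>2 * r) \<inter> lower_central (G\<lparr>carrier := K\<rparr>) l))"
    using assms(11) unfolding eventually_at_top_linorder by blast
  have l: "l \<ge> 2" using assms(10) by simp
  define M where "M = (2 * l + 1) * (\<rho> * c)"
  \<comment> \<open>Chosen so that \<open>C\<^sub>1 powr (a * n)\<close> exceeds \<open>4 ^ (n * M)\<close>, the bound for the number of classes.\<close>
  define a where "a = (real M * ln 4 + 1) / ln C\<^sub>1"
  have lnC: "ln C\<^sub>1 > 0" using assms(8) by simp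
  have a: "a > 0" "a * ln C\<^sub>1 = real M * ln 4 + 1"
    using lnC by (auto simp: a_def add_nonneg_pos intro!: divide_pos_pos)
  \<comment> \<open>Beyond \<open>r1\<close> the growth hypothesis applies; smaller radii are absorbed into the constant \<open>C\<close>.\<close>
  define r1 where "r1 = max 1 (r0 / a)"
  define C where "C = max 1 (4 * C\<^sub>2 * a * r1)"
  have C: "C \<ge> 1" by (simp add: C_def)
  have "ennreal (r ^ (l + 1)) \<le> ennreal C * ennreal_of_enat (RF_growth G S (C * r))" if r: "r \<ge> 1" for r
  proof -
    define r' where "r' = max r r1"
    have r': "r' \<ge> 1" "r' \<ge> r" "r' \<ge> r1" "r' \<le> r1 * r"
      using r mult_mono[of 1 r1 r r] mult_mono[of r1 r1 1 r] by (auto simp: r'_def r1_def)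
    obtain k where k: "r' \<le> 2 ^ k" "2 ^ k \<le> 2 * r'" using ex_power2_between[OF r'(1)] .
    define n :: nat where "n = 2 ^ k"
    have n: "r' \<le> real n" "real n \<le> 2 * r'" using k by (auto simp: n_def)
    have "r0 / a \<le> real n" using r' n by (simp add: r1_def)
    then have s: "a * real n \<ge> r0" using a(1) by (simp add: field_simps)
    have "Lcm {1..n} ^ M \<le> ((4::nat) ^ n) ^ M"
      unfolding n_def by (intro power_mono Lcm_upto_power2_le) simp
    then have "real (Lcm {1..n} ^ M) \<le> real (4 ^ n) ^ M" by (metis of_nat_le_iff of_nat_power)
    also have "\<dots> = exp (real n * (real M * ln 4))"
      by (simp add: exp_of_nat_mult flip: power_mult)
    also have "\<dots> < exp (real n * (real M * ln 4 + 1))"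
      using n r'(1) by simp
    also have "\<dots> = C\<^sub>1 powr (a * real n)"
      using assms(8) a(2) by (simp add: powr_def mult.assoc mult.left_commute mult.commute)
    also have "\<dots> \<le> real (card (word_ball G S (C\<^sub>2 * (a * real n)) \<inter> lower_central (G\<lparr>carrier := K\<rparr>) l))"
      by (rule r0[OF s])
    finally have "Lcm {1..n} ^ M < card (word_ball G S (C\<^sub>2 * (a * real n)) \<inter> lower_central (G\<lparr>carrier := K\<rparr>) l)"
      by (simp only: of_nat_less_iff)
    then have "enat ((n + 1) ^ (l + 1)) \<le> RF_growth G S (2 * (C\<^sub>2 * (a * real n)))"
      unfolding M_def by (rule RF_growth_ge_if_many_short_elements[OF assms(7) K c \<rho> l])
    also have "\<dots> \<le> RF_growth G S (C * r)"
    proof (rule RF_growth_mono)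
      have "2 * (C\<^sub>2 * (a * real n)) \<le> 2 * (C\<^sub>2 * (a * (2 * (r1 * r))))"
        using n r' a(1) assms(9) by (intro mult_left_mono) auto
      also have "\<dots> = (4 * C\<^sub>2 * a * r1) * r" by simp
      also have "\<dots> \<le> C * r" using r by (intro mult_right_mono) (auto simp: C_def)
      finally show "2 * (C\<^sub>2 * (a * real n)) \<le> C * r" .
    qed
    finally have "ennreal_of_enat (enat ((n + 1) ^ (l + 1))) \<le> ennreal_of_enat (RF_growth G S (C * r))"
      by (simp only: ennreal_of_enat_le_iff)
    moreover have "ennreal (r ^ (l + 1)) \<le> ennreal_of_enat (enat ((n + 1) ^ (l + 1)))"
    proof -
      have "r ^ (l + 1) \<le> real (n + 1) ^ (l + 1)" using r r' n by (intro power_mono) auto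
      then show ?thesis
        by (metis ennreal_leI ennreal_of_enat_enat ennreal_of_nat_eq_real_of_nat of_nat_power)
    qed
    moreover have "z \<le> ennreal C * z" for z
      using mult_right_mono[of 1 "ennreal C" z] C by simp
    ultimately show ?thesis by (meson order_trans)
  qed
  then show ?thesis unfolding growth_le_def using C by (intro exI[of _ C]) auto
qed

end
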